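(* Let $n=(n_1+n_2)/2$ and let $\boldsymbol A_1,\dots,\boldsymbol A_m\in\mathbb{R}^{n_1\times n_2}$ be sensing matrices generated with i.i.d. $\mathcal N(0,1)$ entries. Fix $\epsilon\in(0,1)$. If $m\ge c_0(\epsilon^{-2}\log\epsilon^{-1})\,nr\log n$ for some large enough constant $c_0$, then with probability at least $1-c_1\exp(-c_2m\epsilon^2)$, where $c_1$ and $c_2$ are some constants, we have for all rank-$2r$ matrices $\boldsymbol G\in\mathbb{R}^{n_1\times n_2}$, $$\theta_{1/2}(|\mathcal A(\boldsymbol G)|)\in[0.6745-\epsilon,\;0.6745+\epsilon]\,\|\boldsymbol G\|_F,$$ $$\theta_{0.49}(|\mathcal A(\boldsymbol G)|)\in[0.6588-\epsilon,\;0.6588+\epsilon]\,\|\boldsymbol G\|_F,$$ $$\theta_{0.51}(|\mathcal A(\boldsymbol G)|)\in[0.6903-\epsilon,\;0.6903+\epsilon]\,\|\boldsymbol G\|_F.$$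
   Context: $\langle \boldsymbol A,\boldsymbol B\rangle=\mathrm{Tr}(\boldsymbol B^T\boldsymbol A)$, $\mathcal A(\boldsymbol G)=(\langle\boldsymbol A_i,\boldsymbol G\rangle)_{i=1}^m\in\mathbb{R}^m$, $|\cdot|$ on vectors is entrywise, $\|\cdot\|_F$ is the Frobenius norm. For a CDF $F$ and $0<\tau<1$, the $\tau$-quantile is $\theta_\tau(F)=\inf\{x\in\mathbb{R}:F(x)\ge\tau\}$; for a finite sample $\boldsymbol y=(y_i)_{i=1}^m$, $\theta_\tau(\boldsymbol y)=\theta_\tau(\hat F)$ with $\hat F$ the empirical CDF of $y_1,\dots,y_m$. For an interval $I\subset\mathbb{R}$ and $a\ge0$, $I\,a=\{xa:x\in I\}$.
   Formalization: The centres 0.6745, 0.6588, 0.6903 are replaced by the exact quantiles of |N(0,1)| (shown to round to them), as the literal decimals fail for tiny ε; c0 is uniform for ε in (0,ε₁] for each ε₁<1, not on all of (0,1), where no single c0 works. *)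

theory Defs
  imports "HOL-Probability.Probability" "Jordan_Normal_Form.DL_Rank"
begin

unbundle no vec_syntax  \<comment> \<open>so that \<open>$\<close> is indexing of \<open>Jordan_Normal_Form\<close> vectors\<close>

definition mat_inner :: "real mat \<Rightarrow> real mat \<Rightarrow> real" where
  "mat_inner A B = (let P = transpose_mat B * A in \<Sum>i<dim_row P. P $$ (i, i))"

definition frobenius_norm :: "real mat \<Rightarrow> real" where
  "frobenius_norm G = sqrt (\<Sum>i<dim_row G. \<Sum>j<dim_col G. (G $$ (i, j))\<^sup>2)"

definition sensing_map :: "nat \<Rightarrow> (nat \<Rightarrow> real mat) \<Rightarrow> real mat \<Rightarrow> real vec" where
  "sensing_map m A G = vec m (\<lambda>i. mat_inner (A i) G)"

text \<open>
  Junk value: the infimum is only meaningful for \<open>0 < \<tau> < 1\<close> and a distribution function \<open>F\<close>.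
  In particular, samples must be nonempty, since the empirical distribution function of the
  empty sample is constantly \<open>0\<close>.
\<close>

definition quantile :: "real \<Rightarrow> (real \<Rightarrow> real) \<Rightarrow> real" where
  "quantile \<tau> F = Inf {x. F x \<ge> \<tau>}"

definition empirical_cdf :: "real vec \<Rightarrow> real \<Rightarrow> real" where
  "empirical_cdf y x = real (card {i. i < dim_vec y \<and> y $ i \<le> x}) / real (dim_vec y)"

definition sample_quantile :: "real \<Rightarrow> real vec \<Rightarrow> real" where
  "sample_quantile \<tau> y = quantile \<tau> (empirical_cdf y)"

text \<open>
  The quantiles of \<open>\<bar>Z\<bar>\<close> for a standard normal variable \<open>Z\<close>. To four decimals they are
  \<open>0.6745\<close>, \<open>0.6588\<close>, \<open>0.6903\<close> at \<open>\<tau> = 0.5\<close>, \<open>0.49\<close>, \<open>0.51\<close>; the population quantile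
  itself, not its rounded value, is what sample quantiles converge to.
\<close>

definition abs_normal_quantile :: "real \<Rightarrow> real" where
  "abs_normal_quantile \<tau> = quantile \<tau> (cdf (distr std_normal_distribution borel abs))"

definition scale_set :: "real set \<Rightarrow> real \<Rightarrow> real set" where
  "scale_set I a = {x * a | x. x \<in> I}"

definition gaussian_sensing ::
  "'w measure \<Rightarrow> nat \<Rightarrow> nat \<Rightarrow> nat \<Rightarrow> (nat \<Rightarrow> 'w \<Rightarrow> real mat) \<Rightarrow> bool" where
  "gaussian_sensing M m n1 n2 A \<longleftrightarrow>
     prob_space M \<and>
     (\<forall>i<m. \<forall>\<omega>\<in>space M. A i \<omega> \<in> carrier_mat n1 n2) \<and>
     (\<forall>i<m. \<forall>j<n1. \<forall>k<n2. distributed M lborel (\<lambda>\<omega>. A i \<omega> $$ (j, k)) std_normal_density) \<and>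
     prob_space.indep_vars M (\<lambda>_. borel) (\<lambda>(i, j, k) \<omega>. A i \<omega> $$ (j, k))
       ({..<m} \<times> {..<n1} \<times> {..<n2})"

end

theory Submission
  imports Defs "Jordan_Normal_Form.Gram_Schmidt"
begin

text \<open>
  A sample quantile lies in an interval iff the numbers of sample points below its two end points
  are right, so everything is about such counts. By homogeneity only matrices of Frobenius norm
  \<open>1\<close> matter. For one fixed such matrix the measurements are independent standard normals, and as
  the distribution function of \<open>\<bar>Z\<bar>\<close> increases with slope at least \<open>1/5\<close> on \<open>[0, 1.2]\<close>,
  Hoeffding's inequality makes the counts at \<open>q \<plusminus> \<epsilon>/2\<close> right, with a margin proportional to
  \<open>m \<epsilon>\<close>, up to probability \<open>exp (- m \<epsilon>\<^sup>2 / 200)\<close>.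

  A union bound extends this to a net, obtained by rounding the entries of the factors in
  \<open>G = U V\<close> (\<open>U\<close> with orthonormal columns) to a grid of mesh polynomial in \<open>1 / (n1 + n2)\<close> and
  \<open>\<epsilon>\<close>. To pass from the net to all matrices, only those \<open>i\<close> are given up for which
  \<open>\<parallel>A\<^sub>i\<parallel>\<^sup>2\<close> exceeds its mean by a factor of order \<open>1 / \<epsilon>\<close>: by Markov's and
  Hoeffding's inequalities these are too few to use up the margin. A bound on the
  maximum of the norms would instead require a mesh depending on \<open>m\<close>.
\<close>

section \<open>The distribution of the absolute value of a normal variable\<close>

text \<open>The Lagrange remainder of order 5 at \<open>- u\<close> has the sign of
  \<open>(- u) ^ 5\<close>, and that of order 6 in the next lemma is nonnegative, so consecutive
  Taylor polynomials bracket \<open>exp (- u)\<close>.\<close>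

lemma exp_minus_Taylor_upper:
  fixes u :: real
  assumes "u \<ge> 0"
  shows "exp (- u) \<le> (\<Sum>m<5. (- u) ^ m / fact m)"
proof -
  obtain t where "exp (- u) = (\<Sum>m<5. (- u) ^ m / fact m) + exp t / fact 5 * (- u) ^ 5"
    using Maclaurin_exp_le[of "- u" 5] by blast
  moreover have "exp t / fact 5 * (- u) ^ 5 \<le> 0"
    using assms by (intro mult_nonneg_nonpos) (auto simp: power_minus_odd)
  ultimately show ?thesis by linarith
qed

lemma exp_minus_Taylor_lower:
  fixes u :: real
  shows "(\<Sum>m<6. (- u) ^ m / fact m) \<le> exp (- u)"
proof -
  obtain t where "exp (- u) = (\<Sum>m<6. (- u) ^ m / fact m) + exp t / fact 6 * (- u) ^ 6"
    using Maclaurin_exp_le[of "- u" 6] by blast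
  moreover have "exp t / fact 6 * (- u) ^ 6 \<ge> 0"
    by (intro mult_nonneg_nonneg) auto
  ultimately show ?thesis by linarith
qed

lemma inverse_sqrt_two_pi_bounds:
  "0.39894228 \<le> 1 / sqrt (2 * pi)" "1 / sqrt (2 * pi) \<le> 0.398942285"
proof -
  have "sqrt (2 * pi) \<le> sqrt ((1 / 0.39894228)\<^sup>2)"
    by (rule real_sqrt_le_mono) (use pi_approx in \<open>simp add: power2_eq_square\<close>)
  then have "sqrt (2 * pi) \<le> 1 / 0.39894228" by simp
  then show "0.39894228 \<le> 1 / sqrt (2 * pi)" by (simp add: field_simps)
  have "sqrt (2 * pi) \<ge> sqrt ((1 / 0.398942285)\<^sup>2)"
    by (rule real_sqrt_le_mono) (use pi_approx in \<open>simp add: power2_eq_square\<close>)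
  then have "sqrt (2 * pi) \<ge> 1 / 0.398942285" by simp
  then show "1 / sqrt (2 * pi) \<le> 0.398942285" by (simp add: field_simps)
qed

abbreviation abs_normal_cdf :: "real \<Rightarrow> real" where
  "abs_normal_cdf \<equiv> cdf (distr std_normal_distribution borel abs)"

lemma abs_normal_cdf_eq: "abs_normal_cdf x = measure std_normal_distribution {-x..x}"
proof -
  have "measure (distr std_normal_distribution borel abs) {..x} =
      measure std_normal_distribution (abs -` {..x} \<inter> space std_normal_distribution)"
    by (rule measure_distr) auto
  moreover have "abs -` {..x} \<inter> space std_normal_distribution = {-x..x}"
    by auto
  ultimately show ?thesis by (simp add: cdf_def)
qed

text \<open>The distribution function has a kink at 0, but on \<open>x \<ge> 0\<close> it agrees
  with a function \<open>H\<close> that is differentiable everywhere. All later estimates are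
  monotonicity arguments for \<open>H\<close> minus a comparison function.\<close>

lemma abs_normal_cdf_deriv:
  obtains H where "\<And>x. x \<ge> 0 \<Longrightarrow> abs_normal_cdf x = H x" "H 0 = 0"
    "\<And>x. (H has_real_derivative 2 * std_normal_density x) (at x)"
proof -
  have "\<exists>G. \<forall>x. -\<infinity> < ereal x \<longrightarrow> ereal x < \<infinity> \<longrightarrow> (G has_vector_derivative std_normal_density x) (at x)"
    by (rule einterval_antiderivative) (auto simp: std_normal_density_def intro!: continuous_intros)
  then obtain G where G: "\<And>x. (G has_real_derivative std_normal_density x) (at x)"
    by (auto simp: has_real_derivative_iff_has_vector_derivative)
  show thesis
  proof
    fix x :: real assume "x \<ge> 0"
    have "measure std_normal_distribution {-x..x} = (\<integral>t. std_normal_density t * indicator {-x..x} t \<partial>lborel)"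
      proof -
      have "measure std_normal_distribution {-x..x} = (\<integral>t. indicator {-x..x} t \<partial>std_normal_distribution)"
        by simp
      also have "\<dots> = (\<integral>t. std_normal_density t * indicator {-x..x} t \<partial>lborel)"
        by (subst integral_density) auto
      finally show ?thesis .
    qed
    also have "\<dots> = G x - G (- x)"
    proof (rule integral_FTC_Icc_real)
      show "isCont std_normal_density t" for t
        unfolding std_normal_density_def by (intro continuous_intros) simp_all
    qed (use \<open>x \<ge> 0\<close> G in auto)
    finally show "abs_normal_cdf x = (\<lambda>x. G x - G (- x)) x"
      by (simp add: abs_normal_cdf_eq)
  next
    fix x
    \<comment> \<open>The density is even, so both terms contribute the same derivative.\<close>
    show "((\<lambda>x. G x - G (- x)) has_real_derivative 2 * std_normal_density x) (at x)"
      by (auto intro!: derivative_eq_intros G DERIV_chain2[of G _ uminus] simp: std_normal_density_def)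
  qed simp
qed

text \<open>The slope of \<open>H\<close> is \<open>2 * std_normal_density x\<close>, which is at
  least \<open>1 / 5\<close> up to 1.2, so \<open>H x - x / 5\<close> is nondecreasing
  there.\<close>

lemma abs_normal_cdf_increase:
  assumes "0 \<le> a" "a \<le> b" "b \<le> 1.2"
  shows "abs_normal_cdf b - abs_normal_cdf a \<ge> (b - a) / 5"
proof -
  obtain H where H: "\<And>x. x \<ge> 0 \<Longrightarrow> abs_normal_cdf x = H x" 
    "\<And>x. (H has_real_derivative 2 * std_normal_density x) (at x)"
    using abs_normal_cdf_deriv by metis
  have "H a - a / 5 \<le> H b - b / 5"
  proof (rule DERIV_nonneg_imp_nondecreasing[where f = "\<lambda>x. H x - x / 5"])
    fix x assume x: "a \<le> x" "x \<le> b"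
    \<comment> \<open>As \<open>1.2 * 1.2 / 2 = 0.72\<close>, the exponential is at least 0.28, and
      \<open>2 * 0.39894228 * 0.28\<close> exceeds \<open>1 / 5\<close>.\<close>
    have "x * x \<le> 1.2 * 1.2" using x assms by (intro mult_mono) auto
    moreover have "exp (- x\<^sup>2 / 2) \<ge> 1 + (- x\<^sup>2 / 2)" by (rule exp_ge_add_one_self)
    ultimately have e: "exp (- x\<^sup>2 / 2) \<ge> 0.28" by (simp add: power2_eq_square)
    have "0.39894228 * 0.28 \<le> std_normal_density x"
      unfolding std_normal_density_def using e inverse_sqrt_two_pi_bounds(1) by (intro mult_mono) auto
    then have "2 * std_normal_density x - 1 / 5 \<ge> 0" by simp
    moreover have "((\<lambda>x. H x - x / 5) has_real_derivative 2 * std_normal_density x - 1 / 5) (at x)"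
      by (auto intro!: derivative_eq_intros H)
    ultimately show "\<exists>y. ((\<lambda>x. H x - x / 5) has_real_derivative y) (at x) \<and> 0 \<le> y" by blast
  qed (use assms in auto)
  then show ?thesis using H(1)[of a] H(1)[of b] assms by (simp add: field_simps)
qed

text \<open>The polynomial is the term-by-term integral of the Taylor polynomial of
  \<open>exp (- x\<^sup>2 / 2)\<close> that bounds it from below; \<open>0.79788456\<close> is twice
  the lower bound on \<open>1 / sqrt (2 * pi)\<close>. Nonnegativity of the polynomial permits
  replacing the exact factor by this decimal.\<close>

lemma abs_normal_cdf_lower:
  assumes "x \<ge> 0"
    "\<tau> \<le> 0.79788456 * (x - x^3/6 + x^5/40 - x^7/336 + x^9/3456 - x^11/42240)"
    "0 \<le> (x - x^3/6 + x^5/40 - x^7/336 + x^9/3456 - x^11/42240)"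
  shows "\<tau> \<le> abs_normal_cdf x"
proof -
  obtain H where H: "\<And>x. x \<ge> 0 \<Longrightarrow> abs_normal_cdf x = H x" "H 0 = 0"
    "\<And>x. (H has_real_derivative 2 * std_normal_density x) (at x)"
    using abs_normal_cdf_deriv by metis
  define s where "s = 1 / sqrt (2 * pi)"
  have dens: "std_normal_density y = s * exp (- (y\<^sup>2 / 2))" for y
    by (simp add: std_normal_density_def s_def)
  let ?P = "\<lambda>x::real. x - x^3/6 + x^5/40 - x^7/336 + x^9/3456 - x^11/42240"
  let ?p = "\<lambda>x::real. 1 - x^2/2 + x^4/8 - x^6/48 + x^8/384 - x^10/3840"
  have "H 0 - 2 * s * ?P 0 \<le> H x - 2 * s * ?P x"
  proof (rule DERIV_nonneg_imp_nondecreasing[where f = "\<lambda>x. H x - 2 * s * ?P x"])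
    fix y :: real
    have "?p y \<le> exp (- (y\<^sup>2 / 2))"
      using exp_minus_Taylor_lower[of "y\<^sup>2 / 2"]
      by (simp add: eval_nat_numeral fact_numeral field_simps)
    then have "s * ?p y \<le> s * exp (- (y\<^sup>2 / 2))"
      by (intro mult_left_mono) (auto simp: s_def)
    then have "2 * std_normal_density y - 2 * s * ?p y \<ge> 0"
      
      unfolding dens mult.assoc[of 2 s] by linarith
    moreover have "((\<lambda>x. H x - 2 * s * ?P x) has_real_derivative 2 * std_normal_density y - 2 * s * ?p y) (at y)"
      by (auto intro!: derivative_eq_intros H simp: field_simps)
    ultimately show "\<exists>d. ((\<lambda>x. H x - 2 * s * ?P x) has_real_derivative d) (at y) \<and> 0 \<le> d" by blast
  qed (fact assms)
  then have "2 * s * ?P x \<le> H x" using H(2) by simp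
  moreover have "0.79788456 * ?P x \<le> 2 * s * ?P x"
    using inverse_sqrt_two_pi_bounds(1) assms(3) by (intro mult_right_mono) (auto simp: s_def)
  ultimately show ?thesis using assms H(1)[of x] by linarith
qed

text \<open>The mirror image: integration of the Taylor polynomial that ends with a positive term,
  with twice the upper bound on \<open>1 / sqrt (2 * pi)\<close>.\<close>

lemma abs_normal_cdf_upper:
  assumes "x \<ge> 0"
    "0.79788457 * (x - x^3/6 + x^5/40 - x^7/336 + x^9/3456) \<le> \<tau>"
    "0 \<le> (x - x^3/6 + x^5/40 - x^7/336 + x^9/3456)"
  shows "abs_normal_cdf x \<le> \<tau>"
proof -
  obtain H where H: "\<And>x. x \<ge> 0 \<Longrightarrow> abs_normal_cdf x = H x" "H 0 = 0"
    "\<And>x. (H has_real_derivative 2 * std_normal_density x) (at x)"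
    using abs_normal_cdf_deriv by metis
  define s where "s = 1 / sqrt (2 * pi)"
  have dens: "std_normal_density y = s * exp (- (y\<^sup>2 / 2))" for y
    by (simp add: std_normal_density_def s_def)
  let ?P = "\<lambda>x::real. x - x^3/6 + x^5/40 - x^7/336 + x^9/3456"
  let ?p = "\<lambda>x::real. 1 - x^2/2 + x^4/8 - x^6/48 + x^8/384"
  have "2 * s * ?P 0 - H 0 \<le> 2 * s * ?P x - H x"
  proof (rule DERIV_nonneg_imp_nondecreasing[where f = "\<lambda>x. 2 * s * ?P x - H x"])
    fix y :: real
    have "exp (- (y\<^sup>2 / 2)) \<le> ?p y"
      using exp_minus_Taylor_upper[of "y\<^sup>2 / 2"]
      by (simp add: eval_nat_numeral fact_numeral field_simps)
    then have "s * exp (- (y\<^sup>2 / 2)) \<le> s * ?p y"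
      by (intro mult_left_mono) (auto simp: s_def)
    then have "2 * s * ?p y - 2 * std_normal_density y \<ge> 0"
      
      unfolding dens mult.assoc[of 2 s] by linarith
    moreover have "((\<lambda>x. 2 * s * ?P x - H x) has_real_derivative 2 * s * ?p y - 2 * std_normal_density y) (at y)"
      by (auto intro!: derivative_eq_intros H simp: field_simps)
    ultimately show "\<exists>d. ((\<lambda>x. 2 * s * ?P x - H x) has_real_derivative d) (at y) \<and> 0 \<le> d" by blast
  qed (fact assms)
  then have "H x \<le> 2 * s * ?P x" using H(2) by simp
  moreover have "2 * s * ?P x \<le> 0.79788457 * ?P x"
    using inverse_sqrt_two_pi_bounds(2) assms(3) by (intro mult_right_mono) (auto simp: s_def)
  ultimately show ?thesis using assms H(1)[of x] by linarith
qed

text \<open>The intermediate value theorem gives \<open>x\<close> in \<open>[a, b]\<close> with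
  value exactly \<open>\<tau>\<close>. Below \<open>x\<close> the slope bound makes the distribution
  function strictly smaller and above \<open>x\<close> it is monotone, so the set whose infimum is
  the quantile is the ray \<open>{x..}\<close>.\<close>

lemma abs_normal_quantile_between:
  assumes "0 \<le> a" "a \<le> b" "b \<le> 1.2" "0 < \<tau>" "abs_normal_cdf a \<le> \<tau>" "\<tau> \<le> abs_normal_cdf b"
  shows "a \<le> abs_normal_quantile \<tau>" "abs_normal_quantile \<tau> \<le> b"
    "abs_normal_cdf (abs_normal_quantile \<tau>) = \<tau>"
proof -
  obtain H where H: "\<And>x. x \<ge> 0 \<Longrightarrow> abs_normal_cdf x = H x" 
    "\<And>x. (H has_real_derivative 2 * std_normal_density x) (at x)"
    using abs_normal_cdf_deriv by metis
  have "\<exists>x. a \<le> x \<and> x \<le> b \<and> H x = \<tau>"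
    using assms H(1)[of a] H(1)[of b] H(2) 
    by (intro IVT) (auto intro!: DERIV_isCont[OF H(2)])
  then obtain x where x: "a \<le> x" "x \<le> b" "H x = \<tau>" by blast
  have xF: "abs_normal_cdf x = \<tau>" using H(1)[of x] x assms by simp
  have "y < x \<Longrightarrow> abs_normal_cdf y < \<tau>" for y
  proof (cases "y \<ge> 0")
    case True
    assume "y < x"
    then show ?thesis using abs_normal_cdf_increase[of y x] True x assms xF by simp
  next
    \<comment> \<open>For negative \<open>y\<close> the interval \<open>{-y..y}\<close> is empty, so
      the value is 0, which is below \<open>\<tau>\<close>.\<close>
    case False
    then show ?thesis using assms by (simp add: abs_normal_cdf_eq)
  qed
  moreover have "abs_normal_cdf x \<le> abs_normal_cdf y" if "x \<le> y" for y
  proof -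
    interpret prob_space std_normal_distribution
      by (rule prob_space_normal_density) simp
    show ?thesis
      unfolding abs_normal_cdf_eq by (rule finite_measure_mono) (use that in auto)
  qed
  ultimately have "{y. abs_normal_cdf y \<ge> \<tau>} = {x..}"
    using xF by (force simp: not_le[symmetric])
  then have "abs_normal_quantile \<tau> = x" 
    by (simp add: abs_normal_quantile_def quantile_def)
  with x xF show "a \<le> abs_normal_quantile \<tau>" "abs_normal_quantile \<tau> \<le> b"
    "abs_normal_cdf (abs_normal_quantile \<tau>) = \<tau>" by auto
qed

text \<open>The polynomial bounds are evaluated at the two ends of the interval of numbers that
  round to 0.6745. The next two lemmas do the same for 0.6588 and 0.6903.\<close>

lemma abs_normal_quantile_half:
  "0.67445 \<le> abs_normal_quantile (1/2)" "abs_normal_quantile (1/2) \<le> 0.67455"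
  "abs_normal_cdf (abs_normal_quantile (1/2)) = 1/2"
proof -
  have a: "abs_normal_cdf 0.67445 \<le> 1/2" by (rule abs_normal_cdf_upper) (simp_all add: power_divide)
  have b: "1/2 \<le> abs_normal_cdf 0.67455" by (rule abs_normal_cdf_lower) (simp_all add: power_divide)
  show "0.67445 \<le> abs_normal_quantile (1/2)" "abs_normal_quantile (1/2) \<le> 0.67455"
    "abs_normal_cdf (abs_normal_quantile (1/2)) = 1/2"
    using abs_normal_quantile_between[OF _ _ _ _ a b] by simp_all
qed

lemma abs_normal_quantile_49:
  "0.65875 \<le> abs_normal_quantile 0.49" "abs_normal_quantile 0.49 \<le> 0.65885"
  "abs_normal_cdf (abs_normal_quantile 0.49) = 0.49"
proof -
  have a: "abs_normal_cdf 0.65875 \<le> 0.49" by (rule abs_normal_cdf_upper) (simp_all add: power_divide)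
  have b: "0.49 \<le> abs_normal_cdf 0.65885" by (rule abs_normal_cdf_lower) (simp_all add: power_divide)
  show "0.65875 \<le> abs_normal_quantile 0.49" "abs_normal_quantile 0.49 \<le> 0.65885"
    "abs_normal_cdf (abs_normal_quantile 0.49) = 0.49"
    using abs_normal_quantile_between[OF _ _ _ _ a b] by simp_all
qed

lemma abs_normal_quantile_51:
  "0.69025 \<le> abs_normal_quantile 0.51" "abs_normal_quantile 0.51 \<le> 0.69035"
  "abs_normal_cdf (abs_normal_quantile 0.51) = 0.51"
proof -
  have a: "abs_normal_cdf 0.69025 \<le> 0.51" by (rule abs_normal_cdf_upper) (simp_all add: power_divide)
  have b: "0.51 \<le> abs_normal_cdf 0.69035" by (rule abs_normal_cdf_lower) (simp_all add: power_divide)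
  show "0.69025 \<le> abs_normal_quantile 0.51" "abs_normal_quantile 0.51 \<le> 0.69035"
    "abs_normal_cdf (abs_normal_quantile 0.51) = 0.51"
    using abs_normal_quantile_between[OF _ _ _ _ a b] by simp_all
qed

section \<open>A net of the low-rank matrices of norm one\<close>

text \<open>
  The normalised multiples of matrices of rank at most \<open>k\<close>: with the rank condition on the
  unnormalised matrix, the invariance of the rank under scaling is never needed.
\<close>

definition unit_low_rank :: "nat \<Rightarrow> nat \<Rightarrow> nat \<Rightarrow> real mat set" where
  "unit_low_rank n1 n2 k =
    {c \<cdot>\<^sub>m G | c G. G \<in> carrier_mat n1 n2 \<and> vec_space.rank n1 G \<le> k \<and> frobenius_norm (c \<cdot>\<^sub>m G) = 1}"

text \<open>A maximal independent set of columns has as many elements as the rank and spans every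
  column; Gram-Schmidt and normalisation make it orthonormal. Orthonormality later bounds the
  entries of both factors by 1.\<close>

lemma orthonormal_column_basis:
  fixes G :: "real mat"
  assumes G: "G \<in> carrier_mat n1 n2"
  obtains p u c where "p \<le> vec_space.rank n1 G" "p \<le> n1"
    "\<And>k l. k < p \<Longrightarrow> l < p \<Longrightarrow> (\<Sum>i<n1. u i k * u i l) = (if k = l then 1 else 0 :: real)"
    "\<And>i j. i < n1 \<Longrightarrow> j < n2 \<Longrightarrow> G $$ (i, j) = (\<Sum>k<p. u i k * c k j)"
proof -
  interpret cof_vec_space n1 "TYPE(real)" .
  obtain S where S: "maximal S (\<lambda>T. T \<subseteq> set (cols G) \<and> lin_indpt T)" "finite S"
    using maximal_exists_superset[of "set (cols G)" "\<lambda>T. T \<subseteq> set (cols G) \<and> lin_indpt T" "{}"]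
    by (metis (no_types, lifting) List.finite_set empty_subsetI finite.emptyI finite_lin_indpt2 empty_iff)
  have cG: "set (cols G) \<subseteq> carrier_vec n1" using cols_dim G by blast
  have SG: "S \<subseteq> set (cols G)" and Sind: "lin_indpt S"
    using S(1) by (auto simp: maximal_def)
  have rk: "rank G = card S" by (rule rank_card_indpt[OF G S(1)])
  have Sc: "S \<subseteq> carrier_vec n1" using SG cG by blast
  have card_le: "card S \<le> n1"
    using li_le_dim(2)[OF fin_dim _ Sind] Sc dim_is_n by simp
  have colspan: "g \<in> span S" if "g \<in> set (cols G)" for g
  proof (rule ccontr)
    assume g: "g \<notin> span S"
    have gc: "g \<in> carrier_vec n1" using that cG by blast
    have "g \<notin> S" using g in_own_span[of S] Sc by auto
    \<comment> \<open>A column outside the span could join \<open>S\<close> without destroying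
      independence, against maximality.\<close>
    have "lin_indpt (insert g S)"
      using lin_dep_iff_in_span[of S g] Sc Sind gc \<open>g \<notin> S\<close> g by auto
    then have "insert g S \<subseteq> set (cols G) \<and> lin_indpt (insert g S)"
      using that SG by auto
    then have "insert g S = S" using S(1) unfolding maximal_def by blast
    then show False using \<open>g \<notin> S\<close> by blast
  qed
  obtain ws where ws: "set ws = S" "distinct ws" using S(2) finite_distinct_list by blast
  define us where "us = gram_schmidt n1 ws"
  note gs = gram_schmidt_result[of ws us]
  have us: "span S = span (set us)" "corthogonal us" "set us \<subseteq> carrier_vec n1"
     "length us = card S"
    using gs ws Sc Sind distinct_card[OF ws(2)] by (auto simp: us_def)
  define p where "p = length us"
  have usk: "us ! k \<in> carrier_vec n1" if "k < p" for k
    using that us(3) by (auto simp: p_def)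
  \<comment> \<open>Gram-Schmidt yields orthogonal vectors of arbitrary length; dividing by the
    lengths \<open>s k\<close> moves them into the coefficients.\<close>
  define s where "s k = sqrt (\<Sum>i<n1. (us ! k $ i)\<^sup>2)" for k
  define u where "u i k = us ! k $ i / s k" for i k
  have sp: "us ! k \<bullet> us ! l = (\<Sum>i<n1. us ! k $ i * us ! l $ i)" if "l < p" for k l
    using usk[OF that] by (simp add: scalar_prod_def atLeast0LessThan)
  have orth: "us ! k \<bullet> us ! l = 0 \<longleftrightarrow> k \<noteq> l" if "k < p" "l < p" for k l
    using corthogonalD[OF us(2), of k l] that by (simp add: p_def)
  have spos: "s k > 0" if "k < p" for k
  proof -
    have "(\<Sum>i<n1. (us ! k $ i)\<^sup>2) \<noteq> 0"
      using orth[OF that that] sp[OF that, of k] by (simp add: power2_eq_square)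
    moreover have "(\<Sum>i<n1. (us ! k $ i)\<^sup>2) \<ge> 0" by (simp add: sum_nonneg)
    ultimately show ?thesis by (simp add: s_def)
  qed
  have on: "(\<Sum>i<n1. u i k * u i l) = (if k = l then 1 else 0)" if "k < p" "l < p" for k l
  proof -
    have "(\<Sum>i<n1. u i k * u i l) = (us ! k \<bullet> us ! l) / (s k * s l)"
      unfolding sp[OF that(2)] by (simp add: u_def sum_divide_distrib)
    moreover have "us ! k \<bullet> us ! k = s k * s k"
      unfolding sp[OF that(1)] by (simp add: s_def power2_eq_square sum_nonneg)
    ultimately show ?thesis using orth[OF that] spos[OF that(1)] by auto
  qed
  have "\<exists>a. \<forall>i<n1. G $$ (i, j) = (\<Sum>k<p. us ! k $ i * a k)" if "j < n2" for j
  proof -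
    have "col G j \<in> span_list us"
      using colspan[of "col G j"] that G us by (auto simp: cols_def span_list_as_span[OF us(3)])
    then obtain a where a: "col G j = lincomb_list a us" by (auto elim: in_span_listE)
    have "col G j = mat_of_cols n1 us *\<^sub>v vec (length us) a"
      unfolding a by (rule lincomb_list_as_mat_mult) (use us(3) in auto)
    note col_eq = this
    have "G $$ (i, j) = (\<Sum>k<p. us ! k $ i * a k)" if "i < n1" for i
      using that \<open>j < n2\<close> G arg_cong[OF col_eq, of "\<lambda>x. x $ i"]
      by (simp add: scalar_prod_def atLeast0LessThan mat_of_cols_def p_def)
    then show ?thesis by blast
  qed
  then obtain a where a: "\<And>i j. i < n1 \<Longrightarrow> j < n2 \<Longrightarrow> G $$ (i, j) = (\<Sum>k<p. us ! k $ i * a j k)"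
    by metis
  have "G $$ (i, j) = (\<Sum>k<p. u i k * (s k * a j k))" if "i < n1" "j < n2" for i j
    unfolding a[OF that] u_def using spos by (intro sum.cong) (auto simp: less_imp_neq[symmetric])
  then show thesis
    using that[of p u "\<lambda>k j. s k * a j k"] on us rk card_le by (auto simp: p_def)
qed

lemma frobenius_norm_sq:
  assumes "G \<in> carrier_mat n1 n2"
  shows "(frobenius_norm G)\<^sup>2 = (\<Sum>i<n1. \<Sum>j<n2. (G $$ (i, j))\<^sup>2)"
  using assms by (simp add: frobenius_norm_def sum_nonneg)

text \<open>The columns of \<open>u\<close> are unit vectors, so their entries are at most 1. The
  coefficient \<open>c l j\<close> is the inner product of the \<open>l\<close>-th of them with
  column \<open>j\<close> of \<open>F\<close>, and that column has norm at most 1.\<close>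

lemma unit_low_rank_factorization:
  assumes "F \<in> unit_low_rank n1 n2 k"
  obtains u v :: "nat \<times> nat \<Rightarrow> real" where
    "\<And>p. \<bar>u p\<bar> \<le> 1" "\<And>p. \<bar>v p\<bar> \<le> 1"
    "\<And>i j. i < n1 \<Longrightarrow> j < n2 \<Longrightarrow> F $$ (i, j) = (\<Sum>l<min n1 k. u (i, l) * v (l, j))"
proof -
  from assms obtain b G where G: "G \<in> carrier_mat n1 n2" and rk: "vec_space.rank n1 G \<le> k"
    and nF: "frobenius_norm F = 1" and F: "F = b \<cdot>\<^sub>m G" by (auto simp: unit_low_rank_def)
  have FC: "F \<in> carrier_mat n1 n2" using G F by simp
  obtain p u c0 where p: "p \<le> vec_space.rank n1 G" "p \<le> n1"
    and on: "\<And>k l. k < p \<Longrightarrow> l < p \<Longrightarrow> (\<Sum>i<n1. u i k * u i l) = (if k = l then 1 else 0 :: real)"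
    and Gu: "\<And>i j. i < n1 \<Longrightarrow> j < n2 \<Longrightarrow> G $$ (i, j) = (\<Sum>k<p. u i k * c0 k j)"
    by (rule orthonormal_column_basis[OF G]) blast
  \<comment> \<open>The scalar \<open>b\<close> goes into the coefficients, so the rank is only ever
    that of \<open>G\<close>.\<close>
  define c where "c k j = b * c0 k j" for k j
  have Fu: "F $$ (i, j) = (\<Sum>k<p. u i k * c k j)" if "i < n1" "j < n2" for i j
    using that G by (simp add: F Gu c_def sum_distrib_left mult.left_commute)
  have F1: "(\<Sum>i<n1. \<Sum>j<n2. (F $$ (i, j))\<^sup>2) = 1"
    using frobenius_norm_sq[OF FC] nF by simp
  have un: "\<bar>u i l\<bar> \<le> 1" if "i < n1" "l < p" for i l
  proof -
    have "(u i l)\<^sup>2 \<le> (\<Sum>i<n1. (u i l)\<^sup>2)" using that by (intro member_le_sum) auto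
    also have "\<dots> = 1" using on[OF that(2) that(2)] by (simp add: power2_eq_square)
    finally show ?thesis by (simp add: abs_square_le_1)
  qed
  have cn: "\<bar>c l j\<bar> \<le> 1" if "l < p" "j < n2" for l j
  proof -
    \<comment> \<open>Projecting a column of \<open>F\<close> onto the orthonormal vectors recovers
      its coefficients.\<close>
    have "(\<Sum>i<n1. u i l * F $$ (i, j)) = (\<Sum>i<n1. \<Sum>q<p. u i l * u i q * c q j)"
      using that by (intro sum.cong) (auto simp: Fu sum_distrib_left mult.assoc)
    also have "\<dots> = (\<Sum>q<p. (\<Sum>i<n1. u i l * u i q) * c q j)"
      by (subst sum.swap) (simp add: sum_distrib_right)
    also have "\<dots> = (\<Sum>q<p. if q = l then c q j else 0)"
      using that by (intro sum.cong) (auto simp: on)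
    also have "\<dots> = c l j" using that by simp
    finally have "(c l j)\<^sup>2 = (\<Sum>i<n1. u i l * F $$ (i, j))\<^sup>2" by simp
    also have "\<dots> \<le> (\<Sum>i<n1. (u i l)\<^sup>2) * (\<Sum>i<n1. (F $$ (i, j))\<^sup>2)"
      by (rule Cauchy_Schwarz_ineq_sum)
    also have "\<dots> = (\<Sum>i<n1. (F $$ (i, j))\<^sup>2)"
      using on[OF that(1) that(1)] by (simp add: power2_eq_square)
    also have "\<dots> \<le> (\<Sum>j<n2. \<Sum>i<n1. (F $$ (i, j))\<^sup>2)"
      using that by (intro member_le_sum) (auto intro: sum_nonneg)
    also have "\<dots> = 1" using F1 by (subst sum.swap) simp
    finally show ?thesis by (simp add: abs_square_le_1)
  qed
  \<comment> \<open>Padding with zeros gives all matrices the same inner dimension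
    \<open>min n1 k\<close>, whatever their actual rank.\<close>
  define u' where "u' = (\<lambda>(i, l). if i < n1 \<and> l < p then u i l else 0)"
  define v' where "v' = (\<lambda>(l, j). if l < p \<and> j < n2 then c l j else 0)"
  show thesis
  proof
    show "\<bar>u' q\<bar> \<le> 1" "\<bar>v' q\<bar> \<le> 1" for q
      by (auto simp: u'_def v'_def un cn split: prod.split)
    fix i j assume ij: "i < n1" "j < n2"
    have "F $$ (i, j) = (\<Sum>l<p. u' (i, l) * v' (l, j))"
      using ij by (simp add: Fu u'_def v'_def)
    also have "\<dots> = (\<Sum>l<min n1 k. u' (i, l) * v' (l, j))"
      using p rk by (intro sum.mono_neutral_left) (auto simp: u'_def)
    finally show "F $$ (i, j) = (\<Sum>l<min n1 k. u' (i, l) * v' (l, j))" .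
  qed
qed

text \<open>One preimage is picked for each code that occurs. The net then consists of elements of
  \<open>S\<close>, hence of matrices of norm one, whereas a product of rounded factors need not
  have norm one.\<close>

lemma finite_code_representatives:
  assumes "c ` S \<subseteq> C" "finite C"
  obtains R where "R \<subseteq> S" "finite R" "card R \<le> card C" "\<And>x. x \<in> S \<Longrightarrow> \<exists>y\<in>R. c y = c x"
proof
  let ?R = "inv_into S c ` c ` S"
  show "?R \<subseteq> S" by (auto intro: inv_into_into)
  have "finite (c ` S)" using assms finite_subset by blast
  then show "finite ?R" by simp
  have "card ?R \<le> card (c ` S)" by (rule card_image_le) fact
  also have "\<dots> \<le> card C" using assms by (rule card_mono[rotated])
  finally show "card ?R \<le> card C" .
  show "\<exists>y\<in>?R. c y = c x" if "x \<in> S" for x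
    using that by (intro bexI[of _ "inv_into S c (c x)"]) (auto intro: f_inv_into_f)
qed

lemma floor_eq_imp_close:
  fixes x y :: real
  assumes "\<lfloor>x * real N\<rfloor> = \<lfloor>y * real N\<rfloor>" "N > 0"
  shows "\<bar>x - y\<bar> \<le> 1 / real N"
proof -
  have "\<bar>x * real N - y * real N\<bar> \<le> 1" using assms(1) by linarith
  then have "\<bar>x - y\<bar> * real N \<le> 1" by (simp add: left_diff_distrib[symmetric] abs_mult)
  then show ?thesis using assms(2) by (simp add: field_simps)
qed

text \<open>The code of a matrix lists the roundings of the \<open>d * n1 + d * n2\<close> entries
  of its factors, each with \<open>2 * N + 1\<close> possible values. Equal codes put the factor
  entries within \<open>1 / N\<close>, and each of the \<open>d\<close> products in an entry of the
  matrix then changes by at most \<open>2 / N\<close>.\<close>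

lemma unit_low_rank_net:
  fixes N n1 n2 k :: nat
  defines "d \<equiv> min n1 k"
  assumes N: "N > 0"
  obtains R where "R \<subseteq> unit_low_rank n1 n2 k" "finite R" "card R \<le> (2 * N + 1) ^ (d * (n1 + n2))"
    "\<And>G. G \<in> unit_low_rank n1 n2 k \<Longrightarrow>
      \<exists>H\<in>R. \<forall>i<n1. \<forall>j<n2. \<bar>G $$ (i, j) - H $$ (i, j)\<bar> \<le> 2 * real d / real N"
proof -
  let ?S = "unit_low_rank n1 n2 k"
  have "\<forall>G\<in>?S. \<exists>w. (\<forall>p. \<bar>fst w p\<bar> \<le> (1::real)) \<and> (\<forall>p. \<bar>snd w p\<bar> \<le> (1::real)) \<and>
    (\<forall>i<n1. \<forall>j<n2. G $$ (i, j) = (\<Sum>l<d. fst w (i, l) * snd w (l, j)))"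
  proof
    fix G assume "G \<in> ?S"
    then obtain u v :: "nat \<times> nat \<Rightarrow> real" where
      "\<And>p. \<bar>u p\<bar> \<le> 1" "\<And>p. \<bar>v p\<bar> \<le> 1"
      "\<And>i j. i < n1 \<Longrightarrow> j < n2 \<Longrightarrow> G $$ (i, j) = (\<Sum>l<d. u (i, l) * v (l, j))"
      unfolding d_def by (rule unit_low_rank_factorization) blast
    then show "\<exists>w. (\<forall>p. \<bar>fst w p\<bar> \<le> (1::real)) \<and> (\<forall>p. \<bar>snd w p\<bar> \<le> (1::real)) \<and>
      (\<forall>i<n1. \<forall>j<n2. G $$ (i, j) = (\<Sum>l<d. fst w (i, l) * snd w (l, j)))"
      by (intro exI[of _ "(u, v)"]) simp
  qed
  from bchoice[OF this] obtain w where w: "\<And>G. G \<in> ?S \<Longrightarrow>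
     (\<forall>p. \<bar>fst (w G) p\<bar> \<le> (1::real)) \<and> (\<forall>p. \<bar>snd (w G) p\<bar> \<le> (1::real)) \<and>
    (\<forall>i<n1. \<forall>j<n2. G $$ (i, j) = (\<Sum>l<d. fst (w G) (i, l) * snd (w G) (l, j)))"
    by blast
  define u v where "u = (\<lambda>G. fst (w G))" and "v = (\<lambda>G. snd (w G))"
  have uv: "\<bar>u G p\<bar> \<le> 1" "\<bar>v G p\<bar> \<le> 1" if "G \<in> ?S" for G p
    using w[OF that] unfolding u_def v_def by blast+
  have uv3: "G $$ (i, j) = (\<Sum>l<d. u G (i, l) * v G (l, j))"
    if "G \<in> ?S" "i < n1" "j < n2" for G i j
    using w[OF that(1)] that by (auto simp: u_def v_def)
  define A B where "A = {..<n1} \<times> {..<d}" and "B = {..<d} \<times> {..<n2}"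
  define K where "K = {- int N..int N}"
  define c where "c G = (\<lambda>p\<in>A. \<lfloor>u G p * real N\<rfloor>, \<lambda>p\<in>B. \<lfloor>v G p * real N\<rfloor>)" for G
  define C where "C = (PiE A (\<lambda>_. K)) \<times> (PiE B (\<lambda>_. K))"
  have K: "\<lfloor>x * real N\<rfloor> \<in> K" if "\<bar>x\<bar> \<le> 1" for x
  proof -
    have "x * real N \<le> 1 * real N" "(-1) * real N \<le> x * real N"
      using that by (intro mult_right_mono; simp)+
    then show ?thesis by (auto simp: K_def le_floor_iff floor_le_iff)
  qed
  have "c ` ?S \<subseteq> C" by (auto simp: c_def C_def uv intro!: K)
  moreover have "finite C" by (auto simp: C_def A_def B_def K_def intro!: finite_PiE)
  ultimately obtain R where R: "R \<subseteq> ?S" "finite R" "card R \<le> card C"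
    "\<And>G. G \<in> ?S \<Longrightarrow> \<exists>H\<in>R. c H = c G"
    by (rule finite_code_representatives) blast
  have "card C = (2 * N + 1) ^ (d * (n1 + n2))"
    by (simp add: C_def A_def B_def K_def card_cartesian_product card_PiE power_add[symmetric]
        algebra_simps nat_add_distrib nat_mult_distrib)
  then have "card R \<le> (2 * N + 1) ^ (d * (n1 + n2))" using R(3) by simp
  moreover have "\<exists>H\<in>R. \<forall>i<n1. \<forall>j<n2. \<bar>G $$ (i, j) - H $$ (i, j)\<bar> \<le> 2 * real d / real N"
    if G: "G \<in> ?S" for G
  proof -
    from R(4)[OF G] obtain H where H: "H \<in> R" "c H = c G" by blast
    then have HS: "H \<in> ?S" using R(1) by blast
    have cu: "\<bar>u G p - u H p\<bar> \<le> 1 / real N" if "p \<in> A" for p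
      using fun_cong[OF arg_cong[OF H(2), of fst], of p] that N
      by (intro floor_eq_imp_close) (simp_all add: c_def)
    have cv: "\<bar>v G p - v H p\<bar> \<le> 1 / real N" if "p \<in> B" for p
      using fun_cong[OF arg_cong[OF H(2), of snd], of p] that N
      by (intro floor_eq_imp_close) (simp_all add: c_def)
    have "\<bar>G $$ (i, j) - H $$ (i, j)\<bar> \<le> 2 * real d / real N" if ij: "i < n1" "j < n2" for i j
    proof -
      have "\<bar>G $$ (i, j) - H $$ (i, j)\<bar> = \<bar>\<Sum>l<d. u G (i, l) * v G (l, j) - u H (i, l) * v H (l, j)\<bar>"
        by (simp add: uv3[OF G ij] uv3[OF HS ij] sum_subtractf)
      also have "\<dots> \<le> (\<Sum>l<d. \<bar>u G (i, l) * v G (l, j) - u H (i, l) * v H (l, j)\<bar>)"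
        by (rule sum_abs)
      also have "\<dots> \<le> (\<Sum>l<d. 2 / real N)"
      proof (rule sum_mono)
        fix l assume "l \<in> {..<d}"
        then have l: "(i, l) \<in> A" "(l, j) \<in> B" using ij by (auto simp: A_def B_def)
        \<comment> \<open>One factor is changed at a time; the other one is bounded by 1.\<close>
        have "u G (i, l) * v G (l, j) - u H (i, l) * v H (l, j) =
          (u G (i, l) - u H (i, l)) * v G (l, j) + u H (i, l) * (v G (l, j) - v H (l, j))"
          by (simp add: algebra_simps)
        also have "\<bar>\<dots>\<bar> \<le> \<bar>u G (i, l) - u H (i, l)\<bar> * \<bar>v G (l, j)\<bar> + \<bar>u H (i, l)\<bar> * \<bar>v G (l, j) - v H (l, j)\<bar>"
          by (simp add: abs_mult[symmetric])
        also have "\<dots> \<le> (1 / real N) * 1 + 1 * (1 / real N)"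
          using cu[OF l(1)] cv[OF l(2)] uv(1)[OF HS] uv(2)[OF G]
          by (intro add_mono mult_mono) auto
        finally show "\<bar>u G (i, l) * v G (l, j) - u H (i, l) * v H (l, j)\<bar> \<le> 2 / real N" by simp
      qed
      finally show ?thesis by (simp add: mult.commute)
    qed
    then show ?thesis using H(1) by blast
  qed
  ultimately show thesis using that R by blast
qed

section \<open>Concentration of counts for Gaussian measurements\<close>

text \<open>Abstracts from the matrix shape: \<open>i\<close> numbers the measurements, and
  \<open>p\<close> runs over the positions of the entries.\<close>

locale gaussian_family = prob_space +
  fixes m :: nat and I :: "'b set" and a :: "nat \<Rightarrow> 'b \<Rightarrow> 'a \<Rightarrow> real"
  assumes finite_I: "finite I"
    and indep: "indep_vars (\<lambda>_. borel) (\<lambda>(i, p). a i p) ({..<m} \<times> I)"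
    and normal: "\<And>i p. i < m \<Longrightarrow> p \<in> I \<Longrightarrow> distributed M lborel (a i p) std_normal_density"
begin

text \<open>For sensing matrices, \<open>lin i g\<close> is the measurement of the matrix with
  entries \<open>g\<close> by the \<open>i\<close>-th sensing matrix, and \<open>energy i\<close> is
  the squared Frobenius norm of that sensing matrix.\<close>

definition lin :: "nat \<Rightarrow> ('b \<Rightarrow> real) \<Rightarrow> 'a \<Rightarrow> real" where
  "lin i g \<omega> = (\<Sum>p\<in>I. g p * a i p \<omega>)"

definition energy :: "nat \<Rightarrow> 'a \<Rightarrow> real" where
  "energy i \<omega> = (\<Sum>p\<in>I. (a i p \<omega>)\<^sup>2)"

lemma a_measurable: "i < m \<Longrightarrow> p \<in> I \<Longrightarrow> a i p \<in> borel_measurable M"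
  using distributed_measurable[OF normal] by simp

lemma lin_measurable: "i < m \<Longrightarrow> lin i g \<in> borel_measurable M"
  unfolding lin_def[abs_def] using a_measurable by (intro borel_measurable_sum) auto

lemma energy_measurable: "i < m \<Longrightarrow> energy i \<in> borel_measurable M"
  unfolding energy_def[abs_def] using a_measurable by (intro borel_measurable_sum) auto

text \<open>Different \<open>i\<close> use disjoint blocks \<open>{i} \<times> I\<close> of the
  independent entries, and measurable functions of disjoint blocks are independent.\<close>

lemma indep_rows:
  fixes f :: "('b \<Rightarrow> real) \<Rightarrow> real"
  assumes f: "f \<in> borel_measurable (PiM I (\<lambda>_. borel))"
  shows "indep_vars (\<lambda>_. borel) (\<lambda>i \<omega>. f (\<lambda>p\<in>I. a i p \<omega>)) {..<m}"
proof -
  have "indep_vars (\<lambda>i. PiM ({i} \<times> I) (\<lambda>_. borel))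
    (\<lambda>i \<omega>. restrict (\<lambda>q. (\<lambda>(i, p). a i p) q \<omega>) ({i} \<times> I)) {..<m}"
    by (rule indep_vars_restrict[OF indep]) (auto simp: disjoint_family_on_def)
  then have "indep_vars (\<lambda>_. borel)
    (\<lambda>i \<omega>. (\<lambda>x. f (\<lambda>p\<in>I. x (i, p))) (restrict (\<lambda>q. (\<lambda>(i, p). a i p) q \<omega>) ({i} \<times> I))) {..<m}"
  proof (rule indep_vars_compose2)
    fix i
    show "(\<lambda>x. f (\<lambda>p\<in>I. x (i, p))) \<in> borel_measurable (PiM ({i} \<times> I) (\<lambda>_. borel))"
      by (rule measurable_compose[OF _ f], rule measurable_restrict, rule measurable_component_singleton) auto
  qed
  moreover have "(\<lambda>p\<in>I. (restrict (\<lambda>q. (\<lambda>(i, p). a i p) q \<omega>) ({i} \<times> I)) (i, p)) = (\<lambda>p\<in>I. a i p \<omega>)" for i \<omega>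
    by (auto simp: restrict_def)
  ultimately show ?thesis by simp
qed

lemma indep_lin: "indep_vars (\<lambda>_. borel) (\<lambda>i. lin i g) {..<m}"
proof -
  have "(\<lambda>x. \<Sum>p\<in>I. g p * x p) \<in> borel_measurable (PiM I (\<lambda>_. borel))"
    by measurable
  from indep_rows[OF this] show ?thesis by (simp add: lin_def[abs_def])
qed

lemma indep_energy: "indep_vars (\<lambda>_. borel) energy {..<m}"
proof -
  have "(\<lambda>x. \<Sum>p\<in>I. (x p)\<^sup>2 :: real) \<in> borel_measurable (PiM I (\<lambda>_. borel))"
    by measurable
  from indep_rows[OF this] show ?thesis by (simp add: energy_def[abs_def])
qed

lemma indep_row:
  assumes "i < m"
  shows "indep_vars (\<lambda>_. borel) (\<lambda>p. a i p) I"
proof -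
  have "indep_vars (\<lambda>p. PiM {(i, p)} (\<lambda>_. borel))
    (\<lambda>p \<omega>. restrict (\<lambda>q. (\<lambda>(i, p). a i p) q \<omega>) {(i, p)}) I"
    by (rule indep_vars_restrict[OF indep]) (use assms in \<open>auto simp: disjoint_family_on_def\<close>)
  then have "indep_vars (\<lambda>_. borel)
    (\<lambda>p \<omega>. (\<lambda>x. x (i, p)) (restrict (\<lambda>q. (\<lambda>(i, p). a i p) q \<omega>) {(i, p)})) I"
    by (rule indep_vars_compose2) (rule measurable_component_singleton, simp)
  then show ?thesis by simp
qed

text \<open>Independent normal variables sum to a normal one, and the variances
  \<open>(g p)\<^sup>2\<close> add up to 1.\<close>

lemma lin_distributed:
  assumes i: "i < m" and g: "(\<Sum>p\<in>I. (g p)\<^sup>2) = 1"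
  shows "distributed M lborel (lin i g) std_normal_density"
proof -
  \<comment> \<open>Zero coefficients are removed first, since a summand of standard deviation 0 has
    no normal density.\<close>
  define J where "J = {p \<in> I. g p \<noteq> 0}"
  have J: "finite J" "J \<subseteq> I" using finite_I by (auto simp: J_def)
  have sJ: "(\<Sum>p\<in>J. (g p)\<^sup>2) = 1"
    unfolding g[symmetric] using finite_I by (intro sum.mono_neutral_left) (auto simp: J_def)
  then have "J \<noteq> {}" by auto
  have "indep_vars (\<lambda>_. borel) (\<lambda>p \<omega>. g p * a i p \<omega>) J"
    using indep_vars_compose2[OF indep_vars_subset[OF indep_row[OF i] J(2)], of "\<lambda>p x. g p * x"] by simp
  moreover have "distributed M lborel (\<lambda>\<omega>. g p * a i p \<omega>) (normal_density 0 \<bar>g p\<bar>)" if "p \<in> J" for p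
    using normal_density_affine[OF normal[OF i], of p "g p" 0] that by (auto simp: J_def)
  ultimately have "distributed M lborel (\<lambda>\<omega>. \<Sum>p\<in>J. g p * a i p \<omega>)
      (normal_density (\<Sum>p\<in>J. 0) (sqrt (\<Sum>p\<in>J. \<bar>g p\<bar>\<^sup>2)))"
    using J(1) \<open>J \<noteq> {}\<close> by (intro sum_indep_normal) (auto simp: J_def)
  moreover have "(\<lambda>\<omega>. \<Sum>p\<in>J. g p * a i p \<omega>) = lin i g"
    unfolding lin_def using finite_I by (intro ext sum.mono_neutral_left) (auto simp: J_def)
  ultimately show ?thesis using sJ by simp
qed

lemma prob_abs_lin_le:
  assumes i: "i < m" and g: "(\<Sum>p\<in>I. (g p)\<^sup>2) = 1"
  shows "prob {\<omega> \<in> space M. \<bar>lin i g \<omega>\<bar> \<le> x} = abs_normal_cdf x"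
proof -
  note D = lin_distributed[OF assms]
  have "abs_normal_cdf x = measure (distr M lborel (lin i g)) {-x..x}"
    using distributed_distr_eq_density[OF D] by (simp add: abs_normal_cdf_eq)
  also have "\<dots> = prob (lin i g -` {-x..x} \<inter> space M)"
    using distributed_measurable[OF D] by (intro measure_distr) auto
  also have "lin i g -` {-x..x} \<inter> space M = {\<omega> \<in> space M. \<bar>lin i g \<omega>\<bar> \<le> x}"
    by auto
  finally show ?thesis by simp
qed

text \<open>Markov's inequality: each of the \<open>card I\<close> squares has expectation
  1.\<close>

lemma prob_energy_gt:
  assumes i: "i < m" and T: "T > 0"
  shows "prob {\<omega> \<in> space M. energy i \<omega> > T} \<le> real (card I) / T"
proof -
  have sq: "integrable M (\<lambda>\<omega>. (a i p \<omega>)\<^sup>2)" "expectation (\<lambda>\<omega>. (a i p \<omega>)\<^sup>2) = 1" if "p \<in> I" for p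
  proof -
    note D = normal[OF i that]
    show "integrable M (\<lambda>\<omega>. (a i p \<omega>)\<^sup>2)"
      using distributed_integrable[OF D, of "\<lambda>x. x\<^sup>2"] integrable_std_normal_moment[of 2] by simp
    show "expectation (\<lambda>\<omega>. (a i p \<omega>)\<^sup>2) = 1"
      using distributed_integral[OF D, of "\<lambda>x. x\<^sup>2"] integral_std_normal_moment_even[of 1] by simp
  qed
  have int: "integrable M (energy i)"
    unfolding energy_def[abs_def] using sq by (intro Bochner_Integration.integrable_sum) auto
  have "expectation (\<lambda>\<omega>. \<Sum>p\<in>I. (a i p \<omega>)\<^sup>2) = real (card I)"
    using sq by (subst Bochner_Integration.integral_sum) auto
  then have "prob {\<omega> \<in> space M. energy i \<omega> \<ge> T} \<le> real (card I) / T"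
    using integral_Markov_inequality_measure[OF int, of "{}" T] T
    by (simp add: energy_def sum_nonneg)
  moreover have "prob {\<omega> \<in> space M. energy i \<omega> > T} \<le> prob {\<omega> \<in> space M. energy i \<omega> \<ge> T}"
    using energy_measurable[OF i] by (intro finite_measure_mono) auto
  ultimately show ?thesis by linarith
qed

lemma count_eq_sum:
  "real (card {i. i < m \<and> x i \<in> B}) = (\<Sum>i<m. indicator B (x i))"
proof -
  have "{i. i < m \<and> x i \<in> B} = {..<m} \<inter> {i. x i \<in> B}" by auto
  then show ?thesis
    by (simp add: indicator_def of_bool_def sum.If_cases)
qed

text \<open>Hoeffding's inequality for the indicators of \<open>X i \<omega> \<in> B\<close>, which
  are independent with values in \<open>[0, 1]\<close>. A one-sided bound \<open>p\<close> on the
  probabilities is enough, as it moves the threshold in the favourable direction.\<close>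

lemma count_concentration:
  fixes X :: "nat \<Rightarrow> 'a \<Rightarrow> real"
  assumes X: "indep_vars (\<lambda>_. borel) X {..<m}" and B: "B \<in> sets borel" and "m > 0" "t \<ge> 0"
  shows "(\<And>i. i < m \<Longrightarrow> prob {\<omega> \<in> space M. X i \<omega> \<in> B} \<le> p) \<Longrightarrow>
      prob {\<omega> \<in> space M. real m * (p + t) \<le> real (card {i. i < m \<and> X i \<omega> \<in> B})} \<le> exp (- 2 * real m * t\<^sup>2)"
    and "(\<And>i. i < m \<Longrightarrow> p \<le> prob {\<omega> \<in> space M. X i \<omega> \<in> B}) \<Longrightarrow>
      prob {\<omega> \<in> space M. real (card {i. i < m \<and> X i \<omega> \<in> B}) \<le> real m * (p - t)} \<le> exp (- 2 * real m * t\<^sup>2)"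
    and "(\<lambda>\<omega>. real (card {i. i < m \<and> X i \<omega> \<in> B})) \<in> borel_measurable M"
proof -
  define Y where "Y i \<omega> = (indicator B (X i \<omega>) :: real)" for i \<omega>
  have "indep_vars (\<lambda>_. borel) (\<lambda>i \<omega>. indicator B (X i \<omega>) :: real) {..<m}"
    by (rule indep_vars_compose2[OF X]) (use B in auto)
  then have Y: "indep_vars (\<lambda>_. borel) Y {..<m}" by (simp add: Y_def[abs_def])
  have Ym: "Y i \<in> borel_measurable M" if "i < m" for i
    using Y that by (auto simp: indep_vars_def)
  have Xm: "X i \<in> borel_measurable M" if "i < m" for i
    using X that by (auto simp: indep_vars_def)
  interpret Hoeffding_ineq M "{..<m}" Y "\<lambda>_. 0" "\<lambda>_. 1" "\<Sum>i<m. expectation (Y i)"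
    by unfold_locales (use Y in \<open>auto simp: Y_def indicator_def\<close>)
  have EY: "expectation (Y i) = prob {\<omega> \<in> space M. X i \<omega> \<in> B}" if "i < m" for i
  proof -
    have "expectation (Y i) = expectation (indicator {\<omega> \<in> space M. X i \<omega> \<in> B})"
      by (intro Bochner_Integration.integral_cong) (auto simp: Y_def indicator_def)
    then show ?thesis by (simp add: Int_absorb2)
  qed
  have count: "real (card {i. i < m \<and> X i \<omega> \<in> B}) = (\<Sum>i<m. Y i \<omega>)" for \<omega>
    unfolding Y_def by (rule count_eq_sum)
  show cm: "(\<lambda>\<omega>. real (card {i. i < m \<and> X i \<omega> \<in> B})) \<in> borel_measurable M"
    unfolding count using Ym by (intro borel_measurable_sum) auto
  have ex: "- 2 * (real m * t)\<^sup>2 / (\<Sum>i<m. (1 - 0)\<^sup>2) = - 2 * real m * t\<^sup>2"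
    using \<open>m > 0\<close> by (simp add: power2_eq_square)
  have mt: "real m * t \<ge> 0" using \<open>t \<ge> 0\<close> by simp
  have pos: "0 < (\<Sum>i<m. (1 - 0 :: real)\<^sup>2)" using \<open>m > 0\<close> by simp
  {
    assume p: "\<And>i. i < m \<Longrightarrow> prob {\<omega> \<in> space M. X i \<omega> \<in> B} \<le> p"
    have "(\<Sum>i<m. expectation (Y i)) \<le> (\<Sum>i<m. p)" using p EY by (intro sum_mono) auto
    then have le: "(\<Sum>i<m. expectation (Y i)) + real m * t \<le> real m * (p + t)" by (simp add: algebra_simps)
    have "prob {\<omega> \<in> space M. real m * (p + t) \<le> real (card {i. i < m \<and> X i \<omega> \<in> B})} \<le>
       prob {\<omega> \<in> space M. (\<Sum>i<m. Y i \<omega>) \<ge> (\<Sum>i<m. expectation (Y i)) + real m * t}"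
      using Ym le by (intro finite_measure_mono) (auto simp: count intro!: borel_measurable_le borel_measurable_sum)
    also have "\<dots> \<le> exp (- 2 * real m * t\<^sup>2)"
      using Hoeffding_ineq_ge[OF mt pos] ex by simp
    finally show "prob {\<omega> \<in> space M. real m * (p + t) \<le> real (card {i. i < m \<and> X i \<omega> \<in> B})} \<le> exp (- 2 * real m * t\<^sup>2)" .
  next
    assume p: "\<And>i. i < m \<Longrightarrow> p \<le> prob {\<omega> \<in> space M. X i \<omega> \<in> B}"
    have "(\<Sum>i<m. p) \<le> (\<Sum>i<m. expectation (Y i))" using p EY by (intro sum_mono) auto
    then have le: "real m * (p - t) \<le> (\<Sum>i<m. expectation (Y i)) - real m * t" by (simp add: algebra_simps)
    have "prob {\<omega> \<in> space M. real (card {i. i < m \<and> X i \<omega> \<in> B}) \<le> real m * (p - t)} \<le>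
       prob {\<omega> \<in> space M. (\<Sum>i<m. Y i \<omega>) \<le> (\<Sum>i<m. expectation (Y i)) - real m * t}"
      using Ym le by (intro finite_measure_mono) (auto simp: count intro!: borel_measurable_le borel_measurable_sum)
    also have "\<dots> \<le> exp (- 2 * real m * t\<^sup>2)"
      using Hoeffding_ineq_le[OF mt pos] ex by simp
    finally show "prob {\<omega> \<in> space M. real (card {i. i < m \<and> X i \<omega> \<in> B}) \<le> real m * (p - t)} \<le> exp (- 2 * real m * t\<^sup>2)" .
  }
qed

end

section \<open>Sample quantiles and scaled intervals in terms of counts\<close>

lemma empirical_cdf_ge_iff:
  assumes "dim_vec y > 0"
  shows "\<tau> \<le> empirical_cdf y x \<longleftrightarrow>
    \<tau> * real (dim_vec y) \<le> real (card {i. i < dim_vec y \<and> y $ i \<le> x})"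
  using assms by (simp add: empirical_cdf_def le_divide_eq)

text \<open>The arguments at which the empirical distribution function reaches \<open>\<tau>\<close>
  form a ray \<open>{\<theta>..}\<close> starting at a sample point. So the infimum is attained, and
  comparing it with \<open>a\<close> or \<open>b\<close> amounts to a condition on counts.\<close>

lemma
  assumes y: "dim_vec y > 0" and \<tau>: "0 < \<tau>" "\<tau> \<le> 1"
  shows sample_quantile_le_iff: "sample_quantile \<tau> y \<le> b \<longleftrightarrow>
      \<tau> * real (dim_vec y) \<le> real (card {i. i < dim_vec y \<and> y $ i \<le> b})"
    and sample_quantile_ge_iff: "a \<le> sample_quantile \<tau> y \<longleftrightarrow>
      real (card {i. i < dim_vec y \<and> y $ i < a}) < \<tau> * real (dim_vec y)"
proof -
  define m where "m = dim_vec y"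
  define S where "S = {x. \<tau> * real m \<le> real (card {i. i < m \<and> y $ i \<le> x})}"
  have \<tau>m: "\<tau> * real m > 0" using y \<tau> by (simp add: m_def)
  have up: "x' \<in> S" if "x \<in> S" "x \<le> x'" for x x'
  proof -
    have "card {i. i < m \<and> y $ i \<le> x} \<le> card {i. i < m \<and> y $ i \<le> x'}"
      using that by (intro card_mono) auto
    then show ?thesis using that(1) by (simp add: S_def)
  qed
  \<comment> \<open>If enough sample points satisfy \<open>P\<close>, the largest of them belongs to
    \<open>S\<close>. This is used with the trivial \<open>P\<close>, with "at most
    \<open>x\<close>" and with "less than \<open>a\<close>"; positivity of \<open>\<tau>\<close>
    ensures that there is such a point at all.\<close>
  have below: "\<exists>x'\<in>S. P x' \<and> (\<exists>i<m. x' = y $ i)"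
    if "\<tau> * real m \<le> real (card {i. i < m \<and> P (y $ i)})" for P
  proof -
    let ?V = "($) y ` {i. i < m \<and> P (y $ i)}"
    have ne: "{i. i < m \<and> P (y $ i)} \<noteq> {}" 
    proof
      assume "{i. i < m \<and> P (y $ i)} = {}"
      then show False using that \<tau>m by (simp only: card.empty)
    qed
    then have "Max ?V \<in> ?V" by (intro Max_in) auto
    moreover have "Max ?V \<in> S"
    proof -
      have "card {i. i < m \<and> P (y $ i)} \<le> card {i. i < m \<and> y $ i \<le> Max ?V}"
        by (intro card_mono) auto
      then show ?thesis using that by (simp add: S_def)
    qed
    ultimately show ?thesis by auto
  qed
  define W where "W = S \<inter> ($) y ` {..<m}"
  have "\<tau> * real m \<le> real (card {i. i < m \<and> True})" using \<tau> y by (simp add: m_def)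
  from below[OF this] have "W \<noteq> {}" by (auto simp: W_def)
  have "finite W" by (simp add: W_def)
  define \<theta> where "\<theta> = Min W"
  have \<theta>: "\<theta> \<in> S" "\<And>w. w \<in> W \<Longrightarrow> \<theta> \<le> w"
    using Min_in[OF \<open>finite W\<close> \<open>W \<noteq> {}\<close>] \<open>finite W\<close> by (auto simp: \<theta>_def W_def)
  have S: "x \<in> S \<longleftrightarrow> \<theta> \<le> x" for x
  proof
    assume "x \<in> S"
    then obtain x' where "x' \<in> S" "x' \<le> x" "\<exists>i<m. x' = y $ i"
      using below[of "\<lambda>z. z \<le> x"] by (auto simp: S_def)
    then show "\<theta> \<le> x" using \<theta>(2)[of x'] by (force simp: W_def)
  qed (use up \<theta>(1) in blast)
  have "sample_quantile \<tau> y = Inf S"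
    using y by (simp add: sample_quantile_def quantile_def empirical_cdf_ge_iff S_def m_def)
  also have "S = {\<theta>..}" using S by auto
  finally have q: "sample_quantile \<tau> y = \<theta>" by simp
  show "sample_quantile \<tau> y \<le> b \<longleftrightarrow>
      \<tau> * real (dim_vec y) \<le> real (card {i. i < dim_vec y \<and> y $ i \<le> b})"
    unfolding q S[symmetric] by (simp add: S_def m_def)
  have "\<theta> < a \<longleftrightarrow> \<tau> * real m \<le> real (card {i. i < m \<and> y $ i < a})"
  proof
    assume "\<theta> < a"
    then have "card {i. i < m \<and> y $ i \<le> \<theta>} \<le> card {i. i < m \<and> y $ i < a}"
      by (intro card_mono) auto
    then show "\<tau> * real m \<le> real (card {i. i < m \<and> y $ i < a})" using \<theta>(1) by (simp add: S_def)
  next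
    assume "\<tau> * real m \<le> real (card {i. i < m \<and> y $ i < a})"
    then show "\<theta> < a" using below[of "\<lambda>z. z < a"] S by force
  qed
  then show "a \<le> sample_quantile \<tau> y \<longleftrightarrow>
      real (card {i. i < dim_vec y \<and> y $ i < a}) < \<tau> * real (dim_vec y)"
    unfolding q m_def by linarith
qed

lemma mem_scale_set_interval:
  assumes "s \<ge> 0" "l \<le> u"
  shows "x \<in> scale_set {l..u} s \<longleftrightarrow> l * s \<le> x \<and> x \<le> u * s"
proof (cases "s = 0")
  case True
  then show ?thesis using assms by (auto simp: scale_set_def)
next
  case False
  then have "s > 0" using assms by simp
  show ?thesis
  proof
    assume "l * s \<le> x \<and> x \<le> u * s"
    then have "x / s \<in> {l..u}" using \<open>s > 0\<close> by (simp add: field_simps)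
    moreover have "x = (x / s) * s" using \<open>s > 0\<close> by simp
    ultimately show "x \<in> scale_set {l..u} s" unfolding scale_set_def by blast
  qed (use \<open>s > 0\<close> in \<open>auto simp: scale_set_def\<close>)
qed

definition levels :: "real set" where
  "levels = {1/2, 0.49, 0.51}"

lemma finite_levels: "finite levels" and card_levels: "card levels = 3"
  by (simp_all add: levels_def)

text \<open>The coarse bounds 0.6 and 0.7 keep the quantile shifted by up to
  \<open>\<epsilon> / 2\<close> inside \<open>[0, 1.2]\<close>, where the slope bound
  applies.\<close>

lemma levels_quantile:
  assumes "\<tau> \<in> levels"
  shows "0 < \<tau>" "\<tau> \<le> 1" "0.6 \<le> abs_normal_quantile \<tau>" "abs_normal_quantile \<tau> \<le> 0.7"
    "abs_normal_cdf (abs_normal_quantile \<tau>) = \<tau>"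
proof -
  have \<tau>: "\<tau> = 1/2 \<or> \<tau> = 0.49 \<or> \<tau> = 0.51"
    using assms unfolding levels_def insert_iff empty_iff by argo
  then show "0 < \<tau>" "\<tau> \<le> 1" by (elim disjE, simp_all)+
  have lb: "(0.6::real) \<le> 0.67445" "(0.6::real) \<le> 0.65875" "(0.6::real) \<le> 0.69025"
    and ub: "0.67455 \<le> (0.7::real)" "0.65885 \<le> (0.7::real)" "0.69035 \<le> (0.7::real)"
    by simp_all
  show "0.6 \<le> abs_normal_quantile \<tau>"
    using \<tau> order.trans[OF lb(1) abs_normal_quantile_half(1)]
      order.trans[OF lb(2) abs_normal_quantile_49(1)] order.trans[OF lb(3) abs_normal_quantile_51(1)]
    by (elim disjE) (simp_all only:)
  show "abs_normal_quantile \<tau> \<le> 0.7"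
    using \<tau> order.trans[OF abs_normal_quantile_half(2) ub(1)]
      order.trans[OF abs_normal_quantile_49(2) ub(2)] order.trans[OF abs_normal_quantile_51(2) ub(3)]
    by (elim disjE) (simp_all only:)
  show "abs_normal_cdf (abs_normal_quantile \<tau>) = \<tau>"
    using \<tau> abs_normal_quantile_half(3) abs_normal_quantile_49(3) abs_normal_quantile_51(3)
    by (elim disjE) (simp_all only:)
qed

section \<open>The quantile condition and its measurability\<close>

context gaussian_family
begin

text \<open>
  The condition on the \<open>\<tau>\<close>-quantile in terms of counts: in this form its failure is visibly
  an open condition in \<open>h\<close>.
\<close>

definition quantile_event :: "real \<Rightarrow> ('b \<Rightarrow> real) \<Rightarrow> real \<Rightarrow> 'a \<Rightarrow> bool" where
  "quantile_event \<epsilon> h \<tau> \<omega> \<longleftrightarrow>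
     \<tau> * real m \<le> real (card {i. i < m \<and>
       \<bar>lin i h \<omega>\<bar> \<le> (abs_normal_quantile \<tau> + \<epsilon>) * sqrt (\<Sum>p\<in>I. (h p)\<^sup>2)}) \<and>
     real (card {i. i < m \<and>
       \<bar>lin i h \<omega>\<bar> < (abs_normal_quantile \<tau> - \<epsilon>) * sqrt (\<Sum>p\<in>I. (h p)\<^sup>2)}) < \<tau> * real m"

text \<open>The zero matrix cannot be normalised and is treated directly: all \<open>m\<close>
  measurements are at most 0 in absolute value and none is below 0.\<close>

lemma quantile_event_zero:
  assumes "\<tau> \<in> levels" "m > 0" "\<And>p. p \<in> I \<Longrightarrow> h p = 0"
  shows "quantile_event \<epsilon> h \<tau> \<omega>"
proof -
  have "lin i h \<omega> = 0" for i unfolding lin_def by (rule sum.neutral) (simp add: assms(3))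
  moreover have "(\<Sum>p\<in>I. (h p)\<^sup>2) = 0" by (rule sum.neutral) (simp add: assms(3))
  ultimately show ?thesis
    using levels_quantile(1,2)[OF assms(1)] \<open>m > 0\<close> by (simp add: quantile_event_def)
qed

lemma quantile_event_scale:
  assumes "c > 0"
  shows "quantile_event \<epsilon> (\<lambda>p. c * h p) \<tau> \<omega> \<longleftrightarrow> quantile_event \<epsilon> h \<tau> \<omega>"
proof -
  have l: "\<bar>lin i (\<lambda>p. c * h p) \<omega>\<bar> = c * \<bar>lin i h \<omega>\<bar>" for i
    using assms by (simp add: lin_def sum_distrib_left[symmetric] mult.assoc abs_mult)
  have s: "sqrt (\<Sum>p\<in>I. (c * h p)\<^sup>2) = c * sqrt (\<Sum>p\<in>I. (h p)\<^sup>2)"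
    using assms by (simp add: power_mult_distrib sum_distrib_left[symmetric] real_sqrt_mult)
  have le: "c * u \<le> x * (c * z) \<longleftrightarrow> u \<le> x * z" and less: "c * u < x * (c * z) \<longleftrightarrow> u < x * z"
    for u x z :: real
    using assms mult_le_cancel_left_pos[of c u "x * z"] mult_less_cancel_left_pos[of c u "x * z"]
    by (simp_all only: mult.left_commute[of x c z])
  show ?thesis unfolding quantile_event_def l s le less ..
qed

lemma quantile_event_measurable:
  "{\<omega> \<in> space M. quantile_event \<epsilon> h \<tau> \<omega>} \<in> events"
proof -
  have count: "(\<lambda>\<omega>. real (card {i. i < m \<and> lin i h \<omega> \<in> B})) \<in> borel_measurable M"
    if "B \<in> sets borel" for B
    unfolding count_eq_sum
    by (intro borel_measurable_sum measurable_compose[OF lin_measurable borel_measurable_indicator[OF that]])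
      simp
  have "{x :: real. \<bar>x\<bar> \<le> c} \<in> sets borel" "{x :: real. \<bar>x\<bar> < c} \<in> sets borel" for c
    by measurable
  note * = count[OF this(1), unfolded mem_Collect_eq] count[OF this(2), unfolded mem_Collect_eq]
  show ?thesis unfolding quantile_event_def
  proof (rule sets.sets_Collect_conj)
    show "{\<omega> \<in> space M. \<tau> * real m \<le> real (card {i. i < m \<and>
       \<bar>lin i h \<omega>\<bar> \<le> (abs_normal_quantile \<tau> + \<epsilon>) * sqrt (\<Sum>p\<in>I. (h p)\<^sup>2)})} \<in> events"
      by (rule borel_measurable_le[OF borel_measurable_const *(1)])
    show "{\<omega> \<in> space M. real (card {i. i < m \<and>
       \<bar>lin i h \<omega>\<bar> < (abs_normal_quantile \<tau> - \<epsilon>) * sqrt (\<Sum>p\<in>I. (h p)\<^sup>2)}) < \<tau> * real m} \<in> events"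
      by (rule borel_measurable_less[OF *(2) borel_measurable_const])
  qed
qed

text \<open>The condition fails if too many \<open>i\<close> satisfy the strict inequality
  \<open>c * s h < l i h\<close>, or too many satisfy \<open>l i h < d * s h\<close>. Both sides are
  continuous in \<open>h\<close> for the product topology, so these finitely many inequalities
  persist in a neighbourhood.\<close>

lemma quantile_event_fails_open:
  assumes "\<not> quantile_event \<epsilon> h \<tau> \<omega>"
  obtains U where "open U" "h \<in> U" "\<And>h'. h' \<in> U \<Longrightarrow> \<not> quantile_event \<epsilon> h' \<tau> \<omega>"
proof -
  define s where "s h = sqrt (\<Sum>p\<in>I. (h p)\<^sup>2)" for h :: "'b \<Rightarrow> real"
  define l where "l i h = \<bar>lin i h \<omega>\<bar>" for i h
  define c d where "c = abs_normal_quantile \<tau> + \<epsilon>" and "d = abs_normal_quantile \<tau> - \<epsilon>"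
  have cs: "continuous_on UNIV s" unfolding s_def[abs_def]
    by (intro continuous_intros continuous_on_product_coordinates)
  have cl: "continuous_on UNIV (l i)" for i unfolding l_def[abs_def] lin_def
    by (intro continuous_intros continuous_on_product_coordinates)
  have qe: "quantile_event \<epsilon> h \<tau> \<omega> \<longleftrightarrow>
     \<tau> * real m \<le> real (card {i. i < m \<and> l i h \<le> c * s h}) \<and>
     real (card {i. i < m \<and> l i h < d * s h}) < \<tau> * real m" for h
    by (simp add: quantile_event_def s_def l_def c_def d_def)
  consider "real (card {i. i < m \<and> l i h \<le> c * s h}) < \<tau> * real m"
    | "real (card {i. i < m \<and> l i h < d * s h}) \<ge> \<tau> * real m"
    using assms unfolding qe by linarith
  then show thesis
  proof cases
    case 1
    let ?U = "\<Inter>i\<in>{i. i < m \<and> c * s h < l i h}. {h'. c * s h' < l i h'}"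
    show thesis
    proof
      show "open ?U"
        by (intro open_INT open_Collect_less continuous_intros cs cl ballI) auto
      show "h \<in> ?U" by auto
      fix h' assume "h' \<in> ?U"
      then have "card {i. i < m \<and> l i h' \<le> c * s h'} \<le> card {i. i < m \<and> l i h \<le> c * s h}"
        by (intro card_mono) (auto simp: not_less[symmetric])
      then show "\<not> quantile_event \<epsilon> h' \<tau> \<omega>" using 1 unfolding qe by linarith
    qed
  next
    case 2
    let ?U = "\<Inter>i\<in>{i. i < m \<and> l i h < d * s h}. {h'. l i h' < d * s h'}"
    show thesis
    proof
      show "open ?U"
        by (intro open_INT open_Collect_less continuous_intros cs cl ballI) auto
      show "h \<in> ?U" by auto
      fix h' assume "h' \<in> ?U"
      then have "card {i. i < m \<and> l i h < d * s h} \<le> card {i. i < m \<and> l i h' < d * s h'}"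
        by (intro card_mono) auto
      then show "\<not> quantile_event \<epsilon> h' \<tau> \<omega>" using 2 unfolding qe by linarith
    qed
  qed
qed

text \<open>
  The space \<open>M\<close> need not be complete, so the event for all low-rank matrices has to be shown
  measurable: as failure is an open condition in \<open>h\<close>, a countable dense subset suffices.
\<close>

lemma uniform_quantile_event_measurable:
  assumes D: "countable D" "D \<subseteq> S" "\<And>U. open U \<Longrightarrow> U \<inter> S \<noteq> {} \<Longrightarrow> U \<inter> D \<noteq> {}"
    and Q: "finite Q"
  shows "{\<omega> \<in> space M. \<forall>h\<in>S. \<forall>\<tau>\<in>Q. quantile_event \<epsilon> h \<tau> \<omega>} \<in> events"
proof -
  have eq: "(\<forall>h\<in>S. \<forall>\<tau>\<in>Q. quantile_event \<epsilon> h \<tau> \<omega>) \<longleftrightarrow> (\<forall>h\<in>D. \<forall>\<tau>\<in>Q. quantile_event \<epsilon> h \<tau> \<omega>)" for \<omega>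
  proof
    assume *: "\<forall>h\<in>D. \<forall>\<tau>\<in>Q. quantile_event \<epsilon> h \<tau> \<omega>"
    show "\<forall>h\<in>S. \<forall>\<tau>\<in>Q. quantile_event \<epsilon> h \<tau> \<omega>"
    proof (intro ballI, rule ccontr)
      fix h \<tau> assume "h \<in> S" "\<tau> \<in> Q" "\<not> quantile_event \<epsilon> h \<tau> \<omega>"
      from this(3) obtain U where "open U" "h \<in> U" "\<And>h'. h' \<in> U \<Longrightarrow> \<not> quantile_event \<epsilon> h' \<tau> \<omega>"
        by (rule quantile_event_fails_open) blast
      moreover from this(1,2) \<open>h \<in> S\<close> D(3) obtain h' where "h' \<in> U" "h' \<in> D" by blast
      ultimately show False using * \<open>\<tau> \<in> Q\<close> by blast
    qed
  qed (use D(2) in blast)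
  have "(\<Union>z\<in>D \<times> Q. space M - {\<omega> \<in> space M. quantile_event \<epsilon> (fst z) (snd z) \<omega>}) \<in> events"
    by (intro sets.countable_UN' countable_SIGMA countable_finite D(1) Q image_subsetI sets.compl_sets
        quantile_event_measurable)
  then have "space M - (\<Union>z\<in>D \<times> Q. space M - {\<omega> \<in> space M. quantile_event \<epsilon> (fst z) (snd z) \<omega>}) \<in> events"
    by (rule sets.compl_sets)
  moreover have "space M - (\<Union>z\<in>D \<times> Q. space M - {\<omega> \<in> space M. quantile_event \<epsilon> (fst z) (snd z) \<omega>}) =
      {\<omega> \<in> space M. \<forall>h\<in>D. \<forall>\<tau>\<in>Q. quantile_event \<epsilon> h \<tau> \<omega>}"
    by force
  ultimately show ?thesis unfolding eq by (simp only:)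
qed

text \<open>A shift of \<open>\<epsilon> / 2\<close> at slope \<open>1 / 5\<close> changes the
  probability by \<open>\<epsilon> / 10\<close>; half of that is spent on the deviation in
  Hoeffding's inequality and \<open>\<epsilon> / 20\<close> remains as margin. With the energy
  threshold \<open>80 * card I / \<epsilon>\<close>, Markov's inequality gives
  \<open>\<epsilon> / 80\<close>, and a deviation of the same size gives
  \<open>\<epsilon> / 40\<close>. The factor 6 counts two events for each of three levels.\<close>

lemma net_concentration:
  fixes R :: "('b \<Rightarrow> real) set"
  assumes m: "m > 0" and I: "I \<noteq> {}" and \<epsilon>: "0 < \<epsilon>" "\<epsilon> < 1" and R: "finite R"
    and unit: "\<And>g. g \<in> R \<Longrightarrow> (\<Sum>p\<in>I. (g p)\<^sup>2) = 1"
  obtains E where "E \<in> events"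
    "prob E \<ge> 1 - (6 * real (card R) * exp (- real m * \<epsilon>\<^sup>2 / 200) + exp (- real m * \<epsilon>\<^sup>2 / 3200))"
    "\<And>\<omega> g \<tau>. \<omega> \<in> E \<Longrightarrow> g \<in> R \<Longrightarrow> \<tau> \<in> levels \<Longrightarrow>
       real m * (\<tau> + \<epsilon> / 20) < real (card {i. i < m \<and> \<bar>lin i g \<omega>\<bar> \<le> abs_normal_quantile \<tau> + \<epsilon> / 2})"
    "\<And>\<omega> g \<tau>. \<omega> \<in> E \<Longrightarrow> g \<in> R \<Longrightarrow> \<tau> \<in> levels \<Longrightarrow>
       real (card {i. i < m \<and> \<bar>lin i g \<omega>\<bar> \<le> abs_normal_quantile \<tau> - \<epsilon> / 2}) < real m * (\<tau> - \<epsilon> / 20)"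
    "\<And>\<omega>. \<omega> \<in> E \<Longrightarrow>
       real (card {i. i < m \<and> energy i \<omega> > 80 * real (card I) / \<epsilon>}) < real m * (\<epsilon> / 40)"
proof -
  define q where "q = abs_normal_quantile"
  define T where "T = 80 * real (card I) / \<epsilon>"
  have cI: "card I > 0" using I finite_I by (simp add: card_gt_0_iff)
  then have T: "T > 0" using \<epsilon> by (simp add: T_def)
  have \<epsilon>0: "0 \<le> \<epsilon>" using \<epsilon> by simp
  define up where "up g \<tau> = {\<omega> \<in> space M. real (card {i. i < m \<and> lin i g \<omega> \<in> {x. \<bar>x\<bar> \<le> q \<tau> + \<epsilon> / 2}})
      \<le> real m * ((\<tau> + \<epsilon> / 10) - \<epsilon> / 20)}" for g \<tau>
  define lo where "lo g \<tau> = {\<omega> \<in> space M. real m * ((\<tau> - \<epsilon> / 10) + \<epsilon> / 20)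
      \<le> real (card {i. i < m \<and> lin i g \<omega> \<in> {x. \<bar>x\<bar> \<le> q \<tau> - \<epsilon> / 2}})}" for g \<tau>
  define en where "en = {\<omega> \<in> space M. real m * (\<epsilon> / 80 + \<epsilon> / 80)
      \<le> real (card {i. i < m \<and> energy i \<omega> \<in> {T<..}})}"
  have abs_borel: "{x. \<bar>x\<bar> \<le> c} \<in> sets borel" for c :: real by measurable
  have e1: "exp (- 2 * real m * (\<epsilon> / 20)\<^sup>2) = exp (- real m * \<epsilon>\<^sup>2 / 200)"
    by (simp add: power_divide)
  have e2: "exp (- 2 * real m * (\<epsilon> / 80)\<^sup>2) = exp (- real m * \<epsilon>\<^sup>2 / 3200)"
    by (simp add: power_divide)
  have up: "up g \<tau> \<in> events" "prob (up g \<tau>) \<le> exp (- real m * \<epsilon>\<^sup>2 / 200)"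
    if "g \<in> R" "\<tau> \<in> levels" for g \<tau>
  proof -
    note lq = levels_quantile[OF that(2), folded q_def]
    have "\<tau> + \<epsilon> / 10 \<le> abs_normal_cdf (q \<tau> + \<epsilon> / 2)"
      using abs_normal_cdf_increase[of "q \<tau>" "q \<tau> + \<epsilon> / 2"] lq \<epsilon> by simp
    then have "\<tau> + \<epsilon> / 10 \<le> prob {\<omega> \<in> space M. lin i g \<omega> \<in> {x. \<bar>x\<bar> \<le> q \<tau> + \<epsilon> / 2}}" if "i < m" for i
      using prob_abs_lin_le[OF that unit[OF \<open>g \<in> R\<close>]] by simp
    from count_concentration(2)[OF indep_lin abs_borel m, where t = "\<epsilon> / 20" and p = "\<tau> + \<epsilon> / 10", OF _ this]
    show "prob (up g \<tau>) \<le> exp (- real m * \<epsilon>\<^sup>2 / 200)"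
      using \<epsilon> unfolding up_def e1 by simp
    show "up g \<tau> \<in> events" unfolding up_def
      by (rule borel_measurable_le[OF count_concentration(3)[OF indep_lin abs_borel m \<epsilon>0] borel_measurable_const])
  qed
  have lo: "lo g \<tau> \<in> events" "prob (lo g \<tau>) \<le> exp (- real m * \<epsilon>\<^sup>2 / 200)"
    if "g \<in> R" "\<tau> \<in> levels" for g \<tau>
  proof -
    note lq = levels_quantile[OF that(2), folded q_def]
    have "abs_normal_cdf (q \<tau> - \<epsilon> / 2) \<le> \<tau> - \<epsilon> / 10"
      using abs_normal_cdf_increase[of "q \<tau> - \<epsilon> / 2" "q \<tau>"] lq \<epsilon> by simp
    then have "prob {\<omega> \<in> space M. lin i g \<omega> \<in> {x. \<bar>x\<bar> \<le> q \<tau> - \<epsilon> / 2}} \<le> \<tau> - \<epsilon> / 10" if "i < m" for i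
      using prob_abs_lin_le[OF that unit[OF \<open>g \<in> R\<close>]] by simp
    from count_concentration(1)[OF indep_lin abs_borel m, where t = "\<epsilon> / 20" and p = "\<tau> - \<epsilon> / 10", OF _ this]
    show "prob (lo g \<tau>) \<le> exp (- real m * \<epsilon>\<^sup>2 / 200)"
      using \<epsilon> unfolding lo_def e1 by simp
    show "lo g \<tau> \<in> events" unfolding lo_def
      by (rule borel_measurable_le[OF borel_measurable_const count_concentration(3)[OF indep_lin abs_borel m \<epsilon>0]])
  qed
  have en: "en \<in> events" "prob en \<le> exp (- real m * \<epsilon>\<^sup>2 / 3200)"
  proof -
    have "real (card I) / T = \<epsilon> / 80" using cI \<epsilon> by (simp add: T_def)
    then have "prob {\<omega> \<in> space M. energy i \<omega> \<in> {T<..}} \<le> \<epsilon> / 80" if "i < m" for i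
      using prob_energy_gt[OF that T] by (simp only: greaterThan_iff)
    from count_concentration(1)[OF indep_energy _ m, where B = "{T<..}" and t = "\<epsilon> / 80" and p = "\<epsilon> / 80", OF _ _ this]
    show "prob en \<le> exp (- real m * \<epsilon>\<^sup>2 / 3200)"
      using \<epsilon> unfolding en_def e2 by simp
    show "en \<in> events" unfolding en_def
      by (rule borel_measurable_le[OF borel_measurable_const count_concentration(3)[OF indep_energy _ m \<epsilon>0]]) simp
  qed
  define L where "L = R \<times> levels"
  define bad where "bad = (\<Union>z\<in>L. case z of (g, \<tau>) \<Rightarrow> up g \<tau> \<union> lo g \<tau>) \<union> en"
  have fL: "finite L" using R finite_levels by (simp add: L_def)
  have ul: "(case z of (g, \<tau>) \<Rightarrow> up g \<tau> \<union> lo g \<tau>) \<in> events" if z: "z \<in> L" for z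
  proof -
    obtain g \<tau> where g: "z = (g, \<tau>)" "g \<in> R" "\<tau> \<in> levels" using z by (auto simp: L_def)
    show ?thesis unfolding g(1) prod.case by (intro sets.Un up(1) lo(1) g)
  qed
  have ub: "prob (case z of (g, \<tau>) \<Rightarrow> up g \<tau> \<union> lo g \<tau>) \<le> 2 * exp (- real m * \<epsilon>\<^sup>2 / 200)" if z: "z \<in> L" for z
  proof -
    obtain g \<tau> where g: "z = (g, \<tau>)" "g \<in> R" "\<tau> \<in> levels" using z by (auto simp: L_def)
    have "prob (up g \<tau> \<union> lo g \<tau>) \<le> prob (up g \<tau>) + prob (lo g \<tau>)"
      by (intro measure_Un_le up(1) lo(1) g)
    then show ?thesis using up(2)[OF g(2,3)] lo(2)[OF g(2,3)] unfolding g(1) prod.case by linarith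
  qed
  have badm: "bad \<in> events" unfolding bad_def by (intro sets.Un sets.finite_UN fL ul en(1))
  have "prob bad \<le> prob (\<Union>z\<in>L. case z of (g, \<tau>) \<Rightarrow> up g \<tau> \<union> lo g \<tau>) + prob en"
    unfolding bad_def by (intro measure_Un_le sets.finite_UN fL ul en(1))
  also have "prob (\<Union>z\<in>L. case z of (g, \<tau>) \<Rightarrow> up g \<tau> \<union> lo g \<tau>)
     \<le> (\<Sum>z\<in>L. prob (case z of (g, \<tau>) \<Rightarrow> up g \<tau> \<union> lo g \<tau>))"
    by (intro measure_UNION_le fL ul)
  also have "\<dots> \<le> (\<Sum>z\<in>L. 2 * exp (- real m * \<epsilon>\<^sup>2 / 200))" using ub by (rule sum_mono)
  also have "\<dots> = 6 * real (card R) * exp (- real m * \<epsilon>\<^sup>2 / 200)"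
    by (simp add: L_def card_cartesian_product card_levels)
  finally have pb: "prob bad \<le> 6 * real (card R) * exp (- real m * \<epsilon>\<^sup>2 / 200) + exp (- real m * \<epsilon>\<^sup>2 / 3200)"
    using en(2) by linarith
  show thesis
  proof
    show "space M - bad \<in> events" using badm by (rule sets.compl_sets)
    show "prob (space M - bad) \<ge> 1 - (6 * real (card R) * exp (- real m * \<epsilon>\<^sup>2 / 200) + exp (- real m * \<epsilon>\<^sup>2 / 3200))"
      using prob_compl[OF badm] pb by linarith
  next
    fix \<omega> g \<tau> assume \<omega>: "\<omega> \<in> space M - bad" and g: "g \<in> R" "\<tau> \<in> levels"
    then have "\<omega> \<notin> up g \<tau>" "\<omega> \<notin> lo g \<tau>" by (auto simp: bad_def L_def)
    then show "real m * (\<tau> + \<epsilon> / 20) < real (card {i. i < m \<and> \<bar>lin i g \<omega>\<bar> \<le> abs_normal_quantile \<tau> + \<epsilon> / 2})"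
      "real (card {i. i < m \<and> \<bar>lin i g \<omega>\<bar> \<le> abs_normal_quantile \<tau> - \<epsilon> / 2}) < real m * (\<tau> - \<epsilon> / 20)"
      using \<omega> by (auto simp: up_def lo_def q_def add.commute)
  next
    fix \<omega> assume \<omega>: "\<omega> \<in> space M - bad"
    then show "real (card {i. i < m \<and> energy i \<omega> > 80 * real (card I) / \<epsilon>}) < real m * (\<epsilon> / 40)"
      by (auto simp: en_def bad_def T_def)
  qed
qed

text \<open>For an \<open>i\<close> of energy at most \<open>T\<close>, Cauchy-Schwarz bounds the
  squared change of the measurement by \<open>\<epsilon> ^ 3 / (320 * card I) * T = (\<epsilon> /
  2)\<^sup>2\<close>, which turns \<open>\<epsilon> / 2\<close> into \<open>\<epsilon>\<close> in
  the thresholds. The remaining \<open>i\<close> change each count by less than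
  \<open>m * \<epsilon> / 40\<close>, within the margin \<open>m * \<epsilon> / 20\<close>.\<close>

lemma quantile_event_near_net:
  assumes I: "I \<noteq> {}" and \<epsilon>: "0 < \<epsilon>"
    and up: "real m * (\<tau> + \<epsilon> / 20) < real (card {i. i < m \<and> \<bar>lin i g \<omega>\<bar> \<le> abs_normal_quantile \<tau> + \<epsilon> / 2})"
    and lo: "real (card {i. i < m \<and> \<bar>lin i g \<omega>\<bar> \<le> abs_normal_quantile \<tau> - \<epsilon> / 2}) < real m * (\<tau> - \<epsilon> / 20)"
    and en: "real (card {i. i < m \<and> energy i \<omega> > 80 * real (card I) / \<epsilon>}) < real m * (\<epsilon> / 40)"
    and h: "(\<Sum>p\<in>I. (h p)\<^sup>2) = 1"
    and near: "(\<Sum>p\<in>I. (h p - g p)\<^sup>2) \<le> \<epsilon> ^ 3 / (320 * real (card I))"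
  shows "quantile_event \<epsilon> h \<tau> \<omega>"
proof -
  define T where "T = 80 * real (card I) / \<epsilon>"
  define q where "q = abs_normal_quantile \<tau>"
  define bad where "bad = {i. i < m \<and> energy i \<omega> > T}"
  have cI: "card I > 0" using I finite_I by (simp add: card_gt_0_iff)
  have close: "\<bar>lin i h \<omega> - lin i g \<omega>\<bar> \<le> \<epsilon> / 2" if "energy i \<omega> \<le> T" for i
  proof -
    have "(lin i h \<omega> - lin i g \<omega>)\<^sup>2 = (\<Sum>p\<in>I. (h p - g p) * a i p \<omega>)\<^sup>2"
      by (simp add: lin_def sum_subtractf[symmetric] left_diff_distrib)
    also have "\<dots> \<le> (\<Sum>p\<in>I. (h p - g p)\<^sup>2) * (\<Sum>p\<in>I. (a i p \<omega>)\<^sup>2)"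
      by (rule Cauchy_Schwarz_ineq_sum)
    also have "\<dots> \<le> (\<epsilon> ^ 3 / (320 * real (card I))) * T"
      using near that \<epsilon> by (intro mult_mono) (auto simp: energy_def intro: sum_nonneg)
    also have "\<dots> = (\<epsilon> / 2)\<^sup>2"
      using cI \<epsilon> by (simp add: T_def power2_eq_square power3_eq_cube)
    finally have "\<bar>lin i h \<omega> - lin i g \<omega>\<bar> \<le> \<bar>\<epsilon> / 2\<bar>"
      by (simp only: abs_le_square_iff)
    then show ?thesis using \<epsilon> by simp
  qed
  have fb: "finite bad" by (simp add: bad_def)
  have sum_card: "card A \<le> card B + card bad" if "A \<subseteq> B \<union> bad" "finite B" for A B :: "nat set"
    using card_mono[OF _ that(1)] card_Un_le[of B bad] that(2) fb by simp
  have "{i. i < m \<and> \<bar>lin i g \<omega>\<bar> \<le> q + \<epsilon> / 2} \<subseteq> {i. i < m \<and> \<bar>lin i h \<omega>\<bar> \<le> q + \<epsilon>} \<union> bad"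
  proof
    fix i assume i: "i \<in> {i. i < m \<and> \<bar>lin i g \<omega>\<bar> \<le> q + \<epsilon> / 2}"
    show "i \<in> {i. i < m \<and> \<bar>lin i h \<omega>\<bar> \<le> q + \<epsilon>} \<union> bad"
    proof (cases "energy i \<omega> \<le> T")
      case True
      have "\<bar>lin i g \<omega>\<bar> \<le> q + \<epsilon> / 2" using i by simp
      then have "\<bar>lin i h \<omega>\<bar> \<le> q + \<epsilon>" using close[OF True] by linarith
      then show ?thesis using i by simp
    qed (use i in \<open>simp add: bad_def\<close>)
  qed
  from sum_card[OF this] have 1: "card {i. i < m \<and> \<bar>lin i g \<omega>\<bar> \<le> q + \<epsilon> / 2} \<le>
      card {i. i < m \<and> \<bar>lin i h \<omega>\<bar> \<le> q + \<epsilon>} + card bad" by simp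
  have "{i. i < m \<and> \<bar>lin i h \<omega>\<bar> < q - \<epsilon>} \<subseteq> {i. i < m \<and> \<bar>lin i g \<omega>\<bar> \<le> q - \<epsilon> / 2} \<union> bad"
  proof
    fix i assume i: "i \<in> {i. i < m \<and> \<bar>lin i h \<omega>\<bar> < q - \<epsilon>}"
    show "i \<in> {i. i < m \<and> \<bar>lin i g \<omega>\<bar> \<le> q - \<epsilon> / 2} \<union> bad"
    proof (cases "energy i \<omega> \<le> T")
      case True
      have "\<bar>lin i h \<omega>\<bar> < q - \<epsilon>" using i by simp
      then have "\<bar>lin i g \<omega>\<bar> \<le> q - \<epsilon> / 2" using close[OF True] by linarith
      then show ?thesis using i by simp
    qed (use i in \<open>simp add: bad_def\<close>)
  qed
  from sum_card[OF this] have 2: "card {i. i < m \<and> \<bar>lin i h \<omega>\<bar> < q - \<epsilon>} \<le>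
      card {i. i < m \<and> \<bar>lin i g \<omega>\<bar> \<le> q - \<epsilon> / 2} + card bad" by simp
  have "real m * (\<epsilon> / 40) \<le> real m * (\<epsilon> / 20)" using \<epsilon> by (intro mult_left_mono) auto
  then have 3: "real (card bad) < real m * (\<epsilon> / 20)" using en by (simp add: bad_def T_def)
  have "\<tau> * real m \<le> real (card {i. i < m \<and> \<bar>lin i h \<omega>\<bar> \<le> q + \<epsilon>})"
    using 1 3 up unfolding q_def[symmetric] distrib_left mult.commute[of \<tau>] by linarith
  moreover have "real (card {i. i < m \<and> \<bar>lin i h \<omega>\<bar> < q - \<epsilon>}) < \<tau> * real m"
    using 2 3 lo unfolding q_def[symmetric] right_diff_distrib mult.commute[of \<tau>] by linarith
  ultimately show ?thesis unfolding quantile_event_def h q_def[symmetric] by simp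
qed

end

section \<open>Uniform concentration over low-rank matrices\<close>

text \<open>One point of \<open>S\<close> is picked from every basic open set that meets
  \<open>S\<close>.\<close>

lemma countable_dense_subset:
  fixes S :: "'c::second_countable_topology set"
  obtains D where "countable D" "D \<subseteq> S" "\<And>U. open U \<Longrightarrow> U \<inter> S \<noteq> {} \<Longrightarrow> U \<inter> D \<noteq> {}"
proof -
  obtain B :: "'c set set" where B: "countable B" "topological_basis B"
    using ex_countable_basis by blast
  define pick where "pick b = (SOME x. x \<in> b \<inter> S)" for b
  define D where "D = pick ` {b \<in> B. b \<inter> S \<noteq> {}}"
  have pick: "pick b \<in> b \<inter> S" if "b \<inter> S \<noteq> {}" for b
    unfolding pick_def by (rule someI_ex) (use that in blast)
  show thesis
  proof
    show "countable D" using B(1) by (simp add: D_def)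
    show "D \<subseteq> S" using pick by (auto simp: D_def)
    fix U :: "'c set" assume U: "open U" "U \<inter> S \<noteq> {}"
    then obtain x where x: "x \<in> U" "x \<in> S" by blast
    obtain b where b: "b \<in> B" "x \<in> b" "b \<subseteq> U"
      using topological_basisE[OF B(2) U(1) x(1)] by blast
    then have "b \<inter> S \<noteq> {}" using x by blast
    then have "pick b \<in> U \<inter> D" using pick[of b] b by (auto simp: D_def)
    then show "U \<inter> D \<noteq> {}" by blast
  qed
qed

context gaussian_family
begin

text \<open>Matrices enter as functions on all index pairs, whose values out of range are arbitrary;
  scaling relations between them hold on \<open>I\<close> only.\<close>

lemma quantile_event_cong:
  assumes "\<And>p. p \<in> I \<Longrightarrow> h p = h' p"
  shows "quantile_event \<epsilon> h \<tau> \<omega> \<longleftrightarrow> quantile_event \<epsilon> h' \<tau> \<omega>"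
proof -
  have "lin i h \<omega> = lin i h' \<omega>" for i
    unfolding lin_def using assms by (intro sum.cong) auto
  moreover have "(\<Sum>p\<in>I. (h p)\<^sup>2) = (\<Sum>p\<in>I. (h' p)\<^sup>2)"
    using assms by (intro sum.cong) auto
  ultimately show ?thesis by (simp add: quantile_event_def)
qed

text \<open>On the event of \<open>net_concentration\<close> the rest is deterministic: a nonzero
  \<open>h\<close> is a positive multiple of a unit \<open>h'\<close> close to the net, and the
  quantile condition is invariant under that scaling.\<close>

lemma uniform_quantile_concentration:
  assumes m: "m > 0" and I: "I \<noteq> {}" and \<epsilon>: "0 < \<epsilon>" "\<epsilon> < 1" and R: "finite R"
    and unit: "\<And>g. g \<in> R \<Longrightarrow> (\<Sum>p\<in>I. (g p)\<^sup>2) = 1"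
    and net: "\<And>h. h \<in> S \<Longrightarrow> (\<exists>p\<in>I. h p \<noteq> 0) \<Longrightarrow>
      \<exists>c>0. \<exists>h'. (\<forall>p\<in>I. h p = c * h' p) \<and> (\<Sum>p\<in>I. (h' p)\<^sup>2) = 1 \<and>
        (\<exists>g\<in>R. (\<Sum>p\<in>I. (h' p - g p)\<^sup>2) \<le> \<epsilon> ^ 3 / (320 * real (card I)))"
    and meas: "{\<omega> \<in> space M. \<forall>h\<in>S. \<forall>\<tau>\<in>levels. quantile_event \<epsilon> h \<tau> \<omega>} \<in> events"
  shows "prob {\<omega> \<in> space M. \<forall>h\<in>S. \<forall>\<tau>\<in>levels. quantile_event \<epsilon> h \<tau> \<omega>} \<ge>
    1 - (6 * real (card R) * exp (- real m * \<epsilon>\<^sup>2 / 200) + exp (- real m * \<epsilon>\<^sup>2 / 3200))"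
proof (rule net_concentration[OF m I \<epsilon> R unit])
  fix E assume E: "E \<in> events"
    "prob E \<ge> 1 - (6 * real (card R) * exp (- real m * \<epsilon>\<^sup>2 / 200) + exp (- real m * \<epsilon>\<^sup>2 / 3200))"
    and E3: "\<And>\<omega> g \<tau>. \<omega> \<in> E \<Longrightarrow> g \<in> R \<Longrightarrow> \<tau> \<in> levels \<Longrightarrow>
       real m * (\<tau> + \<epsilon> / 20) < real (card {i. i < m \<and> \<bar>lin i g \<omega>\<bar> \<le> abs_normal_quantile \<tau> + \<epsilon> / 2})"
    and E4: "\<And>\<omega> g \<tau>. \<omega> \<in> E \<Longrightarrow> g \<in> R \<Longrightarrow> \<tau> \<in> levels \<Longrightarrow>
       real (card {i. i < m \<and> \<bar>lin i g \<omega>\<bar> \<le> abs_normal_quantile \<tau> - \<epsilon> / 2}) < real m * (\<tau> - \<epsilon> / 20)"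
    and E5: "\<And>\<omega>. \<omega> \<in> E \<Longrightarrow>
       real (card {i. i < m \<and> energy i \<omega> > 80 * real (card I) / \<epsilon>}) < real m * (\<epsilon> / 40)"
  have "quantile_event \<epsilon> h \<tau> \<omega>" if \<omega>: "\<omega> \<in> E" and h: "h \<in> S" and \<tau>: "\<tau> \<in> levels" for \<omega> h \<tau>
  proof (cases "\<exists>p\<in>I. h p \<noteq> 0")
    case True
    from net[OF h True] obtain c h' g where c: "c > 0" "\<forall>p\<in>I. h p = c * h' p"
      "(\<Sum>p\<in>I. (h' p)\<^sup>2) = 1" "g \<in> R" "(\<Sum>p\<in>I. (h' p - g p)\<^sup>2) \<le> \<epsilon> ^ 3 / (320 * real (card I))"
      by (elim exE conjE bexE) (rule that)
    have "quantile_event \<epsilon> h' \<tau> \<omega>"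
      by (rule quantile_event_near_net[OF I \<epsilon>(1) E3[OF \<omega> c(4) \<tau>] E4[OF \<omega> c(4) \<tau>] E5[OF \<omega>] c(3,5)])
    then have "quantile_event \<epsilon> (\<lambda>p. c * h' p) \<tau> \<omega>"
      unfolding quantile_event_scale[OF c(1)] .
    moreover have "quantile_event \<epsilon> h \<tau> \<omega> \<longleftrightarrow> quantile_event \<epsilon> (\<lambda>p. c * h' p) \<tau> \<omega>"
      by (rule quantile_event_cong) (rule c(2)[rule_format])
    ultimately show ?thesis by (simp only:)
  next
    case False
    show ?thesis by (rule quantile_event_zero[OF \<tau> m]) (use False in blast)
  qed
  then have "E \<subseteq> {\<omega> \<in> space M. \<forall>h\<in>S. \<forall>\<tau>\<in>levels. quantile_event \<epsilon> h \<tau> \<omega>}"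
    using sets.sets_into_space[OF E(1)] by (intro subsetI CollectI conjI ballI) auto
  then have "prob E \<le> prob {\<omega> \<in> space M. \<forall>h\<in>S. \<forall>\<tau>\<in>levels. quantile_event \<epsilon> h \<tau> \<omega>}"
    by (rule finite_measure_mono[OF _ meas])
  then show ?thesis using E(2) by linarith
qed

end

section \<open>From sensing matrices to Gaussian families\<close>

lemma gaussian_sensing_family:
  assumes "gaussian_sensing M m n1 n2 A"
  shows "gaussian_family M m ({..<n1} \<times> {..<n2}) (\<lambda>i p \<omega>. A i \<omega> $$ p)"
proof -
  interpret prob_space M using assms by (simp add: gaussian_sensing_def)
  \<comment> \<open>A triple is a pair whose second component is a pair, so the index set already
    has the shape required by the locale.\<close>
  have eq: "(\<lambda>(i, j, k) \<omega>. A i \<omega> $$ (j, k)) = (\<lambda>(i, p) \<omega>. A i \<omega> $$ p)"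
    by (auto simp: fun_eq_iff)
  show ?thesis
    using assms eq by unfold_locales (auto simp: gaussian_sensing_def)
qed

lemma mat_inner_eq_sum:
  assumes "A \<in> carrier_mat n1 n2" "G \<in> carrier_mat n1 n2"
  shows "mat_inner A G = (\<Sum>p\<in>{..<n1} \<times> {..<n2}. G $$ p * A $$ p)"
proof -
  have "mat_inner A G = (\<Sum>j<n2. \<Sum>i<n1. G $$ (i, j) * A $$ (i, j))"
    using assms by (simp add: mat_inner_def Let_def scalar_prod_def atLeast0LessThan)
  also have "\<dots> = (\<Sum>i<n1. \<Sum>j<n2. G $$ (i, j) * A $$ (i, j))"
    by (rule sum.swap)
  finally show ?thesis by (simp add: sum.cartesian_product split_def)
qed

lemma frobenius_norm_eq_sum:
  assumes "G \<in> carrier_mat n1 n2"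
  shows "frobenius_norm G = sqrt (\<Sum>p\<in>{..<n1} \<times> {..<n2}. (G $$ p)\<^sup>2)"
  using assms by (simp add: frobenius_norm_def sum.cartesian_product split_def)

lemma sample_quantile_iff_quantile_event:
  assumes A: "gaussian_sensing M m n1 n2 A" and m: "m > 0" and \<epsilon>: "\<epsilon> \<ge> 0"
    and G: "G \<in> carrier_mat n1 n2" and \<tau>: "\<tau> \<in> levels" and \<omega>: "\<omega> \<in> space M"
  shows "sample_quantile \<tau> (map_vec abs (sensing_map m (\<lambda>i. A i \<omega>) G))
      \<in> scale_set {abs_normal_quantile \<tau> - \<epsilon> .. abs_normal_quantile \<tau> + \<epsilon>} (frobenius_norm G) \<longleftrightarrow>
    gaussian_family.quantile_event m ({..<n1} \<times> {..<n2}) (\<lambda>i p \<omega>. A i \<omega> $$ p) \<epsilon> (($$) G) \<tau> \<omega>"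
proof -
  interpret gaussian_family M m "{..<n1} \<times> {..<n2}" "\<lambda>i p \<omega>. A i \<omega> $$ p"
    by (rule gaussian_sensing_family[OF A])
  define y where "y = map_vec abs (sensing_map m (\<lambda>i. A i \<omega>) G)"
  have y: "dim_vec y = m" by (simp add: y_def sensing_map_def)
  have yi: "y $ i = \<bar>lin i (($$) G) \<omega>\<bar>" if "i < m" for i
    using that mat_inner_eq_sum[OF _ G, of "A i \<omega>"] A \<omega>
    by (simp add: y_def sensing_map_def lin_def gaussian_sensing_def)
  have s1: "{i. i < m \<and> y $ i \<le> b} = {i. i < m \<and> \<bar>lin i (($$) G) \<omega>\<bar> \<le> b}" for b
    using yi by auto
  have s2: "{i. i < m \<and> y $ i < b} = {i. i < m \<and> \<bar>lin i (($$) G) \<omega>\<bar> < b}" for b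
    using yi by auto
  have f: "frobenius_norm G \<ge> 0" by (simp add: frobenius_norm_eq_sum[OF G] sum_nonneg)
  have dy: "dim_vec y > 0" using y m by simp
  have le: "abs_normal_quantile \<tau> - \<epsilon> \<le> abs_normal_quantile \<tau> + \<epsilon>" using \<epsilon> by simp
  note lv = levels_quantile(1,2)[OF \<tau>]
  show ?thesis
    unfolding y_def[symmetric] mem_scale_set_interval[OF f le]
      sample_quantile_le_iff[OF dy lv] sample_quantile_ge_iff[OF dy lv] s1 s2
      quantile_event_def frobenius_norm_eq_sum[OF G, symmetric] y by (rule conj_commute)
qed

lemma unit_low_rank_normalise:
  assumes G: "G \<in> carrier_mat n1 n2" and rk: "vec_space.rank n1 G \<le> k"
    and nz: "\<exists>p\<in>{..<n1} \<times> {..<n2}. G $$ p \<noteq> 0"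
  obtains c F where "c > 0" "F \<in> unit_low_rank n1 n2 k" "F \<in> carrier_mat n1 n2"
    "\<And>p. p \<in> {..<n1} \<times> {..<n2} \<Longrightarrow> G $$ p = c * F $$ p"
proof -
  let ?I = "{..<n1} \<times> {..<n2}"
  let ?c = "frobenius_norm G"
  have "(\<Sum>p\<in>?I. (G $$ p)\<^sup>2) \<noteq> 0" using nz by (simp add: sum_nonneg_eq_0_iff)
  then have c: "?c > 0" by (simp add: frobenius_norm_eq_sum[OF G] sum_nonneg less_le)
  define F where "F = (1 / ?c) \<cdot>\<^sub>m G"
  have F: "F \<in> carrier_mat n1 n2" using G by (simp add: F_def)
  have Fp: "F $$ p = G $$ p / ?c" if "p \<in> ?I" for p
    using that G by (auto simp: F_def)
  have "(\<Sum>p\<in>?I. (F $$ p)\<^sup>2) = (\<Sum>p\<in>?I. (G $$ p)\<^sup>2 / ?c\<^sup>2)"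
    by (intro sum.cong) (auto simp: Fp power_divide)
  also have "\<dots> = (\<Sum>p\<in>?I. (G $$ p)\<^sup>2) / ?c\<^sup>2" by (simp add: sum_divide_distrib)
  also have "(\<Sum>p\<in>?I. (G $$ p)\<^sup>2) = ?c\<^sup>2"
    by (simp add: frobenius_norm_eq_sum[OF G] sum_nonneg)
  finally have "(\<Sum>p\<in>?I. (F $$ p)\<^sup>2) = 1" using c by simp
  then have "frobenius_norm F = 1" by (simp add: frobenius_norm_eq_sum[OF F])
  then have "F \<in> unit_low_rank n1 n2 k" using G rk by (auto simp: unit_low_rank_def F_def)
  from c this F show thesis by (rule that) (use c Fp in simp)
qed

lemma unit_low_rank_norm:
  assumes "F \<in> unit_low_rank n1 n2 k"
  shows "F \<in> carrier_mat n1 n2" "(\<Sum>p\<in>{..<n1} \<times> {..<n2}. (F $$ p)\<^sup>2) = 1"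
proof -
  show F: "F \<in> carrier_mat n1 n2" using assms by (auto simp: unit_low_rank_def)
  show "(\<Sum>p\<in>{..<n1} \<times> {..<n2}. (F $$ p)\<^sup>2) = 1"
    using assms frobenius_norm_eq_sum[OF F] by (auto simp: unit_low_rank_def)
qed

text \<open>Matrices are viewed as functions of the index pair because the function space carries
  the second countable product topology in which a countable dense subset is taken.\<close>

definition low_rank_functions :: "nat \<Rightarrow> nat \<Rightarrow> nat \<Rightarrow> (nat \<times> nat \<Rightarrow> real) set" where
  "low_rank_functions n1 n2 k = ($$) ` {G \<in> carrier_mat n1 n2. vec_space.rank n1 G \<le> k}"

lemma low_rank_concentration:
  assumes A: "gaussian_sensing M m n1 n2 A" and m: "m > 0" and n: "n1 \<ge> 1" "n2 \<ge> 1"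
    and \<epsilon>: "0 < \<epsilon>" "\<epsilon> < 1"
    and R: "finite R" "R \<subseteq> unit_low_rank n1 n2 k"
    and net: "\<And>F. F \<in> unit_low_rank n1 n2 k \<Longrightarrow>
      \<exists>H\<in>R. (\<Sum>p\<in>{..<n1} \<times> {..<n2}. (F $$ p - H $$ p)\<^sup>2) \<le> \<epsilon> ^ 3 / (320 * real (n1 * n2))"
  shows "measure M {\<omega> \<in> space M. \<forall>G \<in> carrier_mat n1 n2. vec_space.rank n1 G \<le> k \<longrightarrow>
     (\<forall>\<tau>\<in>levels. sample_quantile \<tau> (map_vec abs (sensing_map m (\<lambda>i. A i \<omega>) G))
      \<in> scale_set {abs_normal_quantile \<tau> - \<epsilon> .. abs_normal_quantile \<tau> + \<epsilon>} (frobenius_norm G))}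
     \<ge> 1 - (6 * real (card R) * exp (- real m * \<epsilon>\<^sup>2 / 200) + exp (- real m * \<epsilon>\<^sup>2 / 3200))"
proof -
  let ?I = "{..<n1} \<times> {..<n2}"
  interpret gaussian_family M m ?I "\<lambda>i p \<omega>. A i \<omega> $$ p"
    by (rule gaussian_sensing_family[OF A])
  let ?S = "low_rank_functions n1 n2 k"
  let ?R = "(\<lambda>F. ($$) F) ` R"
  obtain D where D: "countable D" "D \<subseteq> ?S" "\<And>U. open U \<Longrightarrow> U \<inter> ?S \<noteq> {} \<Longrightarrow> U \<inter> D \<noteq> {}"
    by (rule countable_dense_subset[of ?S]) blast
  have meas: "{\<omega> \<in> space M. \<forall>h\<in>?S. \<forall>\<tau>\<in>levels. quantile_event \<epsilon> h \<tau> \<omega>} \<in> events"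
    by (rule uniform_quantile_event_measurable[OF D finite_levels])
  have eq: "{\<omega> \<in> space M. \<forall>G \<in> carrier_mat n1 n2. vec_space.rank n1 G \<le> k \<longrightarrow>
     (\<forall>\<tau>\<in>levels. sample_quantile \<tau> (map_vec abs (sensing_map m (\<lambda>i. A i \<omega>) G))
      \<in> scale_set {abs_normal_quantile \<tau> - \<epsilon> .. abs_normal_quantile \<tau> + \<epsilon>} (frobenius_norm G))} =
    {\<omega> \<in> space M. \<forall>h\<in>?S. \<forall>\<tau>\<in>levels. quantile_event \<epsilon> h \<tau> \<omega>}"
  proof (intro Collect_cong conj_cong refl)
    fix \<omega> assume "\<omega> \<in> space M"
    note iff = sample_quantile_iff_quantile_event[OF A m less_imp_le[OF \<epsilon>(1)] _ _ this]
    show "(\<forall>G \<in> carrier_mat n1 n2. vec_space.rank n1 G \<le> k \<longrightarrow>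
     (\<forall>\<tau>\<in>levels. sample_quantile \<tau> (map_vec abs (sensing_map m (\<lambda>i. A i \<omega>) G))
      \<in> scale_set {abs_normal_quantile \<tau> - \<epsilon> .. abs_normal_quantile \<tau> + \<epsilon>} (frobenius_norm G))) \<longleftrightarrow>
     (\<forall>h\<in>?S. \<forall>\<tau>\<in>levels. quantile_event \<epsilon> h \<tau> \<omega>)"
    proof -
      have "(\<forall>G \<in> carrier_mat n1 n2. vec_space.rank n1 G \<le> k \<longrightarrow>
         (\<forall>\<tau>\<in>levels. sample_quantile \<tau> (map_vec abs (sensing_map m (\<lambda>i. A i \<omega>) G))
          \<in> scale_set {abs_normal_quantile \<tau> - \<epsilon> .. abs_normal_quantile \<tau> + \<epsilon>} (frobenius_norm G))) \<longleftrightarrow>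
         (\<forall>G \<in> carrier_mat n1 n2. vec_space.rank n1 G \<le> k \<longrightarrow> (\<forall>\<tau>\<in>levels. quantile_event \<epsilon> (($$) G) \<tau> \<omega>))"
        by (intro ball_cong imp_cong iff refl)
      also have "\<dots> \<longleftrightarrow> (\<forall>h\<in>?S. \<forall>\<tau>\<in>levels. quantile_event \<epsilon> h \<tau> \<omega>)"
        unfolding low_rank_functions_def by auto
      finally show ?thesis .
    qed
  qed
  have "prob {\<omega> \<in> space M. \<forall>h\<in>?S. \<forall>\<tau>\<in>levels. quantile_event \<epsilon> h \<tau> \<omega>} \<ge>
    1 - (6 * real (card ?R) * exp (- real m * \<epsilon>\<^sup>2 / 200) + exp (- real m * \<epsilon>\<^sup>2 / 3200))"
  proof (rule uniform_quantile_concentration[OF m _ \<epsilon> _ _ _ meas])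
    have "(0, 0) \<in> ?I" using n by simp
    then show "?I \<noteq> {}" by blast
    show "finite ?R" using R(1) by simp
    show "(\<Sum>p\<in>?I. (g p)\<^sup>2) = 1" if "g \<in> ?R" for g
    proof -
      from that obtain F where "g = ($$) F" "F \<in> unit_low_rank n1 n2 k" using R(2) by blast
      then show ?thesis using unit_low_rank_norm(2) by (simp only:)
    qed
  next
    fix h assume "h \<in> ?S" "\<exists>p\<in>?I. h p \<noteq> 0"
    then obtain G where G: "h = ($$) G" "G \<in> carrier_mat n1 n2" "vec_space.rank n1 G \<le> k"
      "\<exists>p\<in>?I. G $$ p \<noteq> 0" by (auto simp: low_rank_functions_def)
    obtain c F where F: "c > 0" "F \<in> unit_low_rank n1 n2 k" "\<And>p. p \<in> ?I \<Longrightarrow> G $$ p = c * F $$ p"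
      by (rule unit_low_rank_normalise[OF G(2,3,4)]) blast
    obtain H where H: "H \<in> R" "(\<Sum>p\<in>?I. (F $$ p - H $$ p)\<^sup>2) \<le> \<epsilon> ^ 3 / (320 * real (n1 * n2))"
      using net[OF F(2)] by blast
    have cI: "card ?I = n1 * n2" by (simp add: card_cartesian_product)
    show "\<exists>c>0. \<exists>h'. (\<forall>p\<in>?I. h p = c * h' p) \<and> (\<Sum>p\<in>?I. (h' p)\<^sup>2) = 1 \<and>
        (\<exists>g\<in>?R. (\<Sum>p\<in>?I. (h' p - g p)\<^sup>2) \<le> \<epsilon> ^ 3 / (320 * real (card ?I)))"
      unfolding cI
    proof (intro exI[of _ c] exI[of _ "($$) F"] conjI ballI bexI[of _ "($$) H"])
      show "0 < c" by (rule F(1))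
      show "(\<Sum>p\<in>?I. (F $$ p)\<^sup>2) = 1" by (rule unit_low_rank_norm(2)[OF F(2)])
      show "(\<Sum>p\<in>?I. (F $$ p - H $$ p)\<^sup>2) \<le> \<epsilon> ^ 3 / (320 * real (n1 * n2))" by (rule H(2))
      show "($$) H \<in> ?R" using H(1) by (rule imageI)
      show "h p = c * F $$ p" if "p \<in> ?I" for p using F(3)[OF that] G(1) by simp
    qed
  qed
  \<comment> \<open>Passing from matrices to functions can only merge elements of the net.\<close>
  moreover have "6 * real (card ?R) * exp (- real m * \<epsilon>\<^sup>2 / 200) \<le> 6 * real (card R) * exp (- real m * \<epsilon>\<^sup>2 / 200)"
    using card_image_le[OF R(1), of "\<lambda>F. ($$) F"] by (intro mult_right_mono) auto
  ultimately show ?thesis unfolding eq by linarith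
qed

section \<open>Size and resolution of the net against the number of measurements\<close>

lemma ln_net_base_bound:
  fixes s n \<epsilon> \<epsilon>1 :: real
  assumes s: "s = 2 * n" "n \<ge> 3/2" and \<epsilon>: "0 < \<epsilon>" "\<epsilon> \<le> \<epsilon>1" "\<epsilon>1 < 1"
  shows "ln (111 * s ^ 3 / \<epsilon>\<^sup>2) \<le> (33 / ln (1 / \<epsilon>1) + 6) * (ln (1 / \<epsilon>) * ln n)"
proof -
  define l L L1 where "l = ln n" and "L = ln (1 / \<epsilon>)" and "L1 = ln (1 / \<epsilon>1)"
  have n0: "n > 0" using s by simp
  have "s > 0" using s by simp
  \<comment> \<open>From \<open>n \<ge> 3/2\<close> follows
    \<open>ln n \<ge> 1 - 1 / n \<ge> 1 / 3\<close>; this lower bound is what absorbs additive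
    constants into multiples of \<open>ln n\<close>.\<close>
  have "ln (1 / n) \<le> 1 / n - 1" using n0 by (intro ln_le_minus_one) simp
  moreover have "1 / n \<le> 2 / 3" using s n0 by (simp add: field_simps)
  ultimately have l: "l \<ge> 1 / 3" using n0 by (simp add: l_def ln_div)
  have L1: "L1 > 0" using \<epsilon> by (simp add: L1_def ln_gt_zero)
  have "1 / \<epsilon>1 \<le> 1 / \<epsilon>" using \<epsilon> by (simp add: field_simps)
  then have L: "L1 \<le> L" using \<epsilon> unfolding L1_def L_def by (subst ln_le_cancel_iff) auto
  have "ln (111 :: real) \<le> ln (2 ^ 7)" by (subst ln_le_cancel_iff) auto
  also have "\<dots> = 7 * ln 2" by (subst ln_realpow) auto
  finally have c: "ln (111 :: real) \<le> 7" using ln_2_less_1 by simp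
  have "ln s = ln 2 + l" using n0 by (simp add: s l_def ln_mult)
  then have ls: "ln s \<le> 1 + l" using ln_2_less_1 by simp
  have "ln (111 * s ^ 3 / \<epsilon>\<^sup>2) = ln 111 + 3 * ln s + 2 * L"
    using \<open>s > 0\<close> \<epsilon> by (simp add: L_def ln_div ln_mult ln_realpow)
  \<comment> \<open>The sum is at most \<open>7 + 3 * (1 + l) + 2 * L\<close>, and
    \<open>10 \<le> 30 * l\<close>.\<close>
  also have "\<dots> \<le> 33 * l + 2 * L" using c ls l by linarith
  also have "\<dots> \<le> 33 * l * (L / L1) + 6 * (l * L)"
  proof (rule add_mono)
    \<comment> \<open>The term without \<open>L\<close> is multiplied by \<open>L / L1\<close>; this
      is how the constant comes to depend on \<open>\<epsilon>1\<close>.\<close>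
    have "1 \<le> L / L1" using L L1 by simp
    then have "33 * l * 1 \<le> 33 * l * (L / L1)" using l by (intro mult_left_mono) auto
    then show "33 * l \<le> 33 * l * (L / L1)" by simp
    have "(1 / 3) * L \<le> l * L" using l L L1 by (intro mult_right_mono) auto
    then show "2 * L \<le> 6 * (l * L)" by linarith
  qed
  also have "\<dots> = (33 / L1 + 6) * (L * l)" by (simp add: algebra_simps)
  finally show ?thesis by (simp add: l_def L_def L1_def)
qed

text \<open>The exponent is at most \<open>2 * r * 2 * n\<close>, and \<open>1600 = 4 * 400\<close>
  makes the logarithm of the net size at most \<open>m * \<epsilon>\<^sup>2 / 400\<close>, half of
  what Hoeffding's inequality gains for a single matrix.\<close>

lemma net_size_bound:
  fixes n1 n2 r m d N :: nat and \<epsilon> \<epsilon>1 n :: real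
  assumes \<epsilon>: "0 < \<epsilon>" "\<epsilon> \<le> \<epsilon>1" "\<epsilon>1 < 1" and n: "n = (real n1 + real n2) / 2" "n \<ge> 3/2"
    and d: "d \<le> 2 * r" and N: "real N \<le> 36 * (real n1 + real n2) ^ 3 / \<epsilon>\<^sup>2 + 1"
    and m: "real m \<ge> (1600 * (33 / ln (1 / \<epsilon>1) + 6)) * ((1 / \<epsilon>\<^sup>2) * ln (1 / \<epsilon>)) * n * real r * ln n"
  shows "real ((2 * N + 1) ^ (d * (n1 + n2))) \<le> exp (real m * \<epsilon>\<^sup>2 / 400)"
proof -
  define s where "s = real n1 + real n2"
  define x where "x = 111 * s ^ 3 / \<epsilon>\<^sup>2"
  define C where "C = 33 / ln (1 / \<epsilon>1) + 6"
  have s: "s = 2 * n" using n by (simp add: s_def)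
  have "1 ^ 3 \<le> s ^ 3" using s n by (intro power_mono) auto
  moreover have "\<epsilon>\<^sup>2 \<le> 1" using \<epsilon> by (simp add: power_le_one)
  ultimately have "\<epsilon>\<^sup>2 \<le> s ^ 3" by simp
  then have one: "1 \<le> s ^ 3 / \<epsilon>\<^sup>2" using \<epsilon> by simp
  have x0: "x > 0" using one by (simp add: x_def)
  \<comment> \<open>With \<open>X = s ^ 3 / \<epsilon>\<^sup>2 \<ge> 1\<close>, the left side is at
    most \<open>72 * X + 3\<close>.\<close>
  have "real (2 * N + 1) \<le> x" using N one by (simp add: x_def s_def)
  then have "real (2 * N + 1) ^ (d * (n1 + n2)) \<le> x ^ (d * (n1 + n2))"
    by (intro power_mono) auto
  also have "\<dots> = exp (real (d * (n1 + n2)) * ln x)"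
    using x0 by (simp only: exp_of_nat_mult exp_ln)
  also have "real (d * (n1 + n2)) * ln x \<le> (4 * real r * n) * (C * (ln (1 / \<epsilon>) * ln n))"
  proof (rule mult_mono)
    have "real d * s \<le> (2 * real r) * s" using d s n by (intro mult_right_mono) auto
    then show "real (d * (n1 + n2)) \<le> 4 * real r * n" using s by (simp add: s_def)
    show "ln x \<le> C * (ln (1 / \<epsilon>) * ln n)"
      unfolding x_def C_def by (rule ln_net_base_bound[OF s n(2) \<epsilon>])
    show "0 \<le> ln x" using one by (intro ln_ge_zero) (simp add: x_def)
  qed (use n in auto)
  also have "\<dots> = (1600 * C * ((1 / \<epsilon>\<^sup>2) * ln (1 / \<epsilon>)) * n * real r * ln n) * \<epsilon>\<^sup>2 / 400"
    using \<epsilon> by simp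
  also have "\<dots> \<le> real m * \<epsilon>\<^sup>2 / 400"
    using m \<epsilon> unfolding C_def by (intro divide_right_mono mult_right_mono) auto
  finally show ?thesis by simp
qed

text \<open>With \<open>q = n1 * n2\<close> the claim says
  \<open>(2 * d * q / N)\<^sup>2 \<le> \<epsilon> ^ 3 / 320\<close>. Since
  \<open>d * q \<le> (n1 + n2) ^ 3\<close>, the choice \<open>36 = 2 * 18\<close> bounds the base by
  \<open>\<epsilon>\<^sup>2 / 18\<close>, and \<open>18\<^sup>2 = 324\<close> exceeds 320.\<close>

lemma grid_resolution:
  fixes n1 n2 d N :: nat and \<epsilon> :: real
  assumes \<epsilon>: "0 < \<epsilon>" "\<epsilon> < 1" and n: "n1 \<ge> 1" "n2 \<ge> 1" and d: "d \<le> n1"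
    and N: "36 * (real n1 + real n2) ^ 3 / \<epsilon>\<^sup>2 \<le> real N"
  shows "real (n1 * n2) * (2 * real d / real N)\<^sup>2 \<le> \<epsilon> ^ 3 / (320 * real (n1 * n2))"
proof -
  define s where "s = real n1 + real n2"
  define q where "q = real (n1 * n2)"
  have s: "s \<ge> 1" using n by (simp add: s_def)
  have q: "q > 0" using n by (simp add: q_def)
  have "0 < 36 * s ^ 3 / \<epsilon>\<^sup>2" using s \<epsilon> by simp
  then have N0: "real N > 0" using N unfolding s_def by linarith
  have "real d * (real n1 * real n2) \<le> s * (s * s)"
    using d by (intro mult_mono) (auto simp: s_def)
  then have dq: "real d * q \<le> s ^ 3" by (simp add: q_def power3_eq_cube)
  have "36 * s ^ 3 \<le> real N * \<epsilon>\<^sup>2" using N \<epsilon> by (simp add: s_def field_simps)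
  then have "2 * (real d * q) * 18 \<le> real N * \<epsilon>\<^sup>2" using dq by linarith
  then have "2 * real d / real N * q \<le> \<epsilon>\<^sup>2 / 18" using N0 by (simp add: field_simps)
  then have "(2 * real d / real N * q)\<^sup>2 \<le> (\<epsilon>\<^sup>2 / 18)\<^sup>2"
    using q N0 by (intro power_mono) auto
  also have "\<dots> = \<epsilon> ^ 3 * (\<epsilon> / 324)" by (simp add: power2_eq_square power3_eq_cube)
  also have "\<dots> \<le> \<epsilon> ^ 3 * (1 / 320)" using \<epsilon> by (intro mult_left_mono) auto
  finally have "(2 * real d / real N)\<^sup>2 * q\<^sup>2 \<le> \<epsilon> ^ 3 / 320" by (simp only: power_mult_distrib mult_1_right times_divide_eq_right)
  then have "q * (2 * real d / real N)\<^sup>2 \<le> \<epsilon> ^ 3 / (320 * q)"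
    using q by (simp only: power2_eq_square[of q]) (simp add: pos_le_divide_eq mult_ac)
  then show ?thesis by (simp only: q_def)
qed

text \<open>
  For \<open>n = 1\<close> the hypothesis on \<open>m\<close> is void since \<open>ln n = 0\<close>, but then there are only two
  matrices of norm one.
\<close>

lemma low_rank_net_size:
  fixes \<epsilon> \<epsilon>1 n :: real
  assumes A: "gaussian_sensing M m n1 n2 A" and m: "m > 0" and n: "n1 \<ge> 1" "n2 \<ge> 1"
    and nn: "n = (real n1 + real n2) / 2"
    and \<epsilon>: "0 < \<epsilon>" "\<epsilon> \<le> \<epsilon>1" "\<epsilon>1 < 1"
    and large: "real m \<ge> (1600 * (33 / ln (1 / \<epsilon>1) + 6)) * ((1 / \<epsilon>\<^sup>2) * ln (1 / \<epsilon>)) * n * real r * ln n"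
  shows "\<exists>R. finite R \<and> R \<subseteq> unit_low_rank n1 n2 (2 * r) \<and> real (card R) \<le> 2 * exp (real m * \<epsilon>\<^sup>2 / 400) \<and>
    (\<forall>F\<in>unit_low_rank n1 n2 (2 * r). \<exists>H\<in>R.
      (\<Sum>p\<in>{..<n1} \<times> {..<n2}. (F $$ p - H $$ p)\<^sup>2) \<le> \<epsilon> ^ 3 / (320 * real (n1 * n2)))"
proof (cases "n1 = 1 \<and> n2 = 1")
  case True
  let ?S = "unit_low_rank n1 n2 (2 * r)"
  have I: "{..<n1} \<times> {..<n2} = {(0, 0)}" using True by auto
  have pm: "F $$ (0, 0) = 1 \<or> F $$ (0, 0) = - 1" if "F \<in> ?S" for F
    using unit_low_rank_norm(2)[OF that] unfolding I by (simp add: power2_eq_1_iff)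
  have sub: "?S \<subseteq> (\<lambda>x. mat n1 n2 (\<lambda>_. x)) ` {1, - 1}"
  proof
    fix F assume F: "F \<in> ?S"
    have "F = mat n1 n2 (\<lambda>_. F $$ (0, 0))"
      using unit_low_rank_norm(1)[OF F] True by (intro eq_matI) auto
    then show "F \<in> (\<lambda>x. mat n1 n2 (\<lambda>_. x)) ` {1, - 1}" using pm[OF F] by (metis imageI insertCI)
  qed
  have fin: "finite ?S" by (rule finite_subset[OF sub]) simp
  have "card ?S \<le> card ((\<lambda>x. mat n1 n2 (\<lambda>_. x)) ` {1, - 1 :: real})" by (rule card_mono[OF _ sub]) simp
  also have "\<dots> \<le> card {1, - 1 :: real}" by (rule card_image_le) simp
  finally have "real (card ?S) \<le> 2" by simp
  also have "\<dots> \<le> 2 * exp (real m * \<epsilon>\<^sup>2 / 400)" by simp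
  finally have c: "real (card ?S) \<le> 2 * exp (real m * \<epsilon>\<^sup>2 / 400)" .
  show ?thesis
  \<comment> \<open>The finite set of all normalised matrices serves as its own net.\<close>
  proof (intro exI[of _ ?S] conjI fin subset_refl c ballI)
    fix F assume "F \<in> ?S"
    then show "\<exists>H\<in>?S. (\<Sum>p\<in>{..<n1} \<times> {..<n2}. (F $$ p - H $$ p)\<^sup>2) \<le> \<epsilon> ^ 3 / (320 * real (n1 * n2))"
      using \<epsilon>(1) by (intro bexI[of _ F]) auto
  qed
next
  case False
  define d where "d = min n1 (2 * r)"
  define N where "N = nat \<lceil>36 * (real n1 + real n2) ^ 3 / \<epsilon>\<^sup>2\<rceil>"
  have N: "36 * (real n1 + real n2) ^ 3 / \<epsilon>\<^sup>2 \<le> real N"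
    "real N \<le> 36 * (real n1 + real n2) ^ 3 / \<epsilon>\<^sup>2 + 1"
    unfolding N_def by (simp_all add: real_nat_ceiling_ge of_nat_nat)
  have "0 < 36 * (real n1 + real n2) ^ 3 / \<epsilon>\<^sup>2" using n \<epsilon> by simp
  then have N0: "N > 0" using N by linarith
  \<comment> \<open>Outside the 1 by 1 case the integer \<open>n1 + n2\<close> is at least
    3.\<close>
  have "n \<ge> 3/2" using False n nn by auto
  then have size: "real ((2 * N + 1) ^ (d * (n1 + n2))) \<le> exp (real m * \<epsilon>\<^sup>2 / 400)"
    by (intro net_size_bound[OF \<epsilon> nn _ _ N(2) large]) (simp_all add: d_def)
  obtain R where R: "R \<subseteq> unit_low_rank n1 n2 (2 * r)" "finite R" "card R \<le> (2 * N + 1) ^ (d * (n1 + n2))"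
    and net: "\<And>G. G \<in> unit_low_rank n1 n2 (2 * r) \<Longrightarrow>
      \<exists>H\<in>R. \<forall>i<n1. \<forall>j<n2. \<bar>G $$ (i, j) - H $$ (i, j)\<bar> \<le> 2 * real d / real N"
    unfolding d_def by (rule unit_low_rank_net[OF N0, of n1 n2 "2 * r"]) blast
  have "real (card R) \<le> real ((2 * N + 1) ^ (d * (n1 + n2)))" using R(3) by (simp only: of_nat_le_iff)
  also note size
  also have "exp (real m * \<epsilon>\<^sup>2 / 400) \<le> 2 * exp (real m * \<epsilon>\<^sup>2 / 400)" by simp
  finally have c: "real (card R) \<le> 2 * exp (real m * \<epsilon>\<^sup>2 / 400)" .
  show ?thesis
  proof (intro exI[of _ R] conjI R(1,2) c ballI)
    fix F assume "F \<in> unit_low_rank n1 n2 (2 * r)"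
    then obtain H where H: "H \<in> R"
      "\<forall>i<n1. \<forall>j<n2. \<bar>F $$ (i, j) - H $$ (i, j)\<bar> \<le> 2 * real d / real N" using net by blast
    have "(\<Sum>p\<in>{..<n1} \<times> {..<n2}. (F $$ p - H $$ p)\<^sup>2) \<le>
        (\<Sum>p\<in>{..<n1} \<times> {..<n2}. (2 * real d / real N)\<^sup>2)"
    proof (rule sum_mono)
      fix p assume "p \<in> {..<n1} \<times> {..<n2}"
      then have "\<bar>F $$ p - H $$ p\<bar> \<le> 2 * real d / real N" using H(2) by (cases p) simp
      then have "\<bar>F $$ p - H $$ p\<bar>\<^sup>2 \<le> (2 * real d / real N)\<^sup>2" by (rule power_mono) simp
      then show "(F $$ p - H $$ p)\<^sup>2 \<le> (2 * real d / real N)\<^sup>2" by simp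
    qed
    also have "\<dots> = real (n1 * n2) * (2 * real d / real N)\<^sup>2"
      by (simp add: card_cartesian_product)
    also have "\<dots> \<le> \<epsilon> ^ 3 / (320 * real (n1 * n2))"
      by (rule grid_resolution[OF \<epsilon>(1) _ n _ N(1)]) (use \<epsilon> in \<open>simp_all add: d_def\<close>)
    finally show "\<exists>H\<in>R. (\<Sum>p\<in>{..<n1} \<times> {..<n2}. (F $$ p - H $$ p)\<^sup>2) \<le> \<epsilon> ^ 3 / (320 * real (n1 * n2))"
      using H(1) by blast
  qed
qed

text \<open>The net size \<open>exp (m * \<epsilon>\<^sup>2 / 400)\<close> uses up half of the decay
  \<open>exp (- m * \<epsilon>\<^sup>2 / 200)\<close>. The remaining rate \<open>1 / 400\<close> is
  better than the \<open>1 / 3200\<close> of the energy event, which therefore determines the final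
  rate.\<close>

lemma failure_probability_bound:
  fixes K :: real
  assumes K: "K \<le> 2 * exp (real m * \<epsilon>\<^sup>2 / 400)"
  shows "6 * K * exp (- real m * \<epsilon>\<^sup>2 / 200) + exp (- real m * \<epsilon>\<^sup>2 / 3200) \<le> 13 * exp (- (1 / 3200) * real m * \<epsilon>\<^sup>2)"
proof -
  let ?x = "real m * \<epsilon>\<^sup>2"
  have "6 * K * exp (- ?x / 200) \<le> 6 * (2 * exp (?x / 400)) * exp (- ?x / 200)"
    using K by (intro mult_right_mono) auto
  also have "\<dots> = 12 * exp (?x / 400 + - ?x / 200)" unfolding exp_add by simp
  also have "\<dots> \<le> 12 * exp (- (1 / 3200) * ?x)"
    by simp
  finally have 1: "6 * K * exp (- ?x / 200) \<le> 12 * exp (- (1 / 3200) * ?x)" .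
  have 2: "- ?x / 3200 = - (1 / 3200) * ?x" by simp
  show ?thesis using 1 unfolding 2[symmetric] by (simp add: mult.assoc)
qed

theorem proposition1:
  shows
    "\<bar>abs_normal_quantile (1/2) - 0.6745\<bar> \<le> 0.00005 \<and>
     \<bar>abs_normal_quantile 0.49 - 0.6588\<bar> \<le> 0.00005 \<and>
     \<bar>abs_normal_quantile 0.51 - 0.6903\<bar> \<le> 0.00005 \<and>
     (\<exists>c1>0. \<exists>c2>0. \<forall>\<epsilon>\<^sub>1. 0 < \<epsilon>\<^sub>1 \<and> \<epsilon>\<^sub>1 < 1 \<longrightarrow>
       (\<exists>c0>0. \<forall>(\<epsilon>::real) (n1::nat) (n2::nat) (r::nat) (m::nat) (n::real)
            (M :: 'w measure) (A :: nat \<Rightarrow> 'w \<Rightarrow> real mat).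
          0 < \<epsilon> \<and> \<epsilon> \<le> \<epsilon>\<^sub>1 \<and> 1 \<le> n1 \<and> 1 \<le> n2 \<and> 1 \<le> r \<and> 1 \<le> m \<and>
          n = (real n1 + real n2) / 2 \<and>
          gaussian_sensing M m n1 n2 A \<and>
          real m \<ge> c0 * ((1 / \<epsilon>\<^sup>2) * ln (1 / \<epsilon>)) * n * real r * ln n \<longrightarrow>
          measure M {\<omega> \<in> space M.
            \<forall>G \<in> carrier_mat n1 n2. vec_space.rank n1 G \<le> 2 * r \<longrightarrow>
              (let y = map_vec abs (sensing_map m (\<lambda>i. A i \<omega>) G);
                   q = abs_normal_quantile
               in sample_quantile (1/2) y
                    \<in> scale_set {q (1/2) - \<epsilon> .. q (1/2) + \<epsilon>} (frobenius_norm G) \<and>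
                  sample_quantile 0.49 y
                    \<in> scale_set {q 0.49 - \<epsilon> .. q 0.49 + \<epsilon>} (frobenius_norm G) \<and>
                  sample_quantile 0.51 y
                    \<in> scale_set {q 0.51 - \<epsilon> .. q 0.51 + \<epsilon>} (frobenius_norm G))}
            \<ge> 1 - c1 * exp (- c2 * real m * \<epsilon>\<^sup>2)))"
proof -
  have q: "\<bar>abs_normal_quantile (1/2) - 0.6745\<bar> \<le> 0.00005"
    "\<bar>abs_normal_quantile 0.49 - 0.6588\<bar> \<le> 0.00005"
    "\<bar>abs_normal_quantile 0.51 - 0.6903\<bar> \<le> 0.00005"
    using abs_normal_quantile_half(1,2) abs_normal_quantile_49(1,2) abs_normal_quantile_51(1,2)
    by (intro abs_leI; simp)+
  have main: "\<exists>c0>0. \<forall>(\<epsilon>::real) (n1::nat) (n2::nat) (r::nat) (m::nat) (n::real)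
            (M :: 'w measure) (A :: nat \<Rightarrow> 'w \<Rightarrow> real mat).
          0 < \<epsilon> \<and> \<epsilon> \<le> \<epsilon>1 \<and> 1 \<le> n1 \<and> 1 \<le> n2 \<and> 1 \<le> r \<and> 1 \<le> m \<and>
          n = (real n1 + real n2) / 2 \<and>
          gaussian_sensing M m n1 n2 A \<and>
          real m \<ge> c0 * ((1 / \<epsilon>\<^sup>2) * ln (1 / \<epsilon>)) * n * real r * ln n \<longrightarrow>
          measure M {\<omega> \<in> space M.
            \<forall>G \<in> carrier_mat n1 n2. vec_space.rank n1 G \<le> 2 * r \<longrightarrow>
              (let y = map_vec abs (sensing_map m (\<lambda>i. A i \<omega>) G);
                   q = abs_normal_quantile
               in sample_quantile (1/2) y
                    \<in> scale_set {q (1/2) - \<epsilon> .. q (1/2) + \<epsilon>} (frobenius_norm G) \<and>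
                  sample_quantile 0.49 y
                    \<in> scale_set {q 0.49 - \<epsilon> .. q 0.49 + \<epsilon>} (frobenius_norm G) \<and>
                  sample_quantile 0.51 y
                    \<in> scale_set {q 0.51 - \<epsilon> .. q 0.51 + \<epsilon>} (frobenius_norm G))}
            \<ge> 1 - 13 * exp (- (1 / 3200) * real m * \<epsilon>\<^sup>2)"
    if \<epsilon>1: "0 < \<epsilon>1 \<and> \<epsilon>1 < 1" for \<epsilon>1 :: real
  proof (intro exI[of _ "1600 * (33 / ln (1 / \<epsilon>1) + 6)"] conjI allI impI)
    \<comment> \<open>This \<open>c0\<close> grows without bound as \<open>\<epsilon>1\<close>
      approaches 1: there \<open>ln (1 / \<epsilon>)\<close> may be close to 0, and the lower bound
      on \<open>m\<close> must still dominate the logarithm of the net size.\<close>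
    show "0 < 1600 * (33 / ln (1 / \<epsilon>1) + 6)" using \<epsilon>1 by (simp add: add_pos_pos)
    fix \<epsilon> n :: real and n1 n2 r m :: nat and M :: "'w measure" and A :: "nat \<Rightarrow> 'w \<Rightarrow> real mat"
    assume h: "0 < \<epsilon> \<and> \<epsilon> \<le> \<epsilon>1 \<and> 1 \<le> n1 \<and> 1 \<le> n2 \<and> 1 \<le> r \<and> 1 \<le> m \<and>
      n = (real n1 + real n2) / 2 \<and> gaussian_sensing M m n1 n2 A \<and>
      real m \<ge> (1600 * (33 / ln (1 / \<epsilon>1) + 6)) * ((1 / \<epsilon>\<^sup>2) * ln (1 / \<epsilon>)) * n * real r * ln n"
    then have h': "gaussian_sensing M m n1 n2 A" "m > 0" "n1 \<ge> 1" "n2 \<ge> 1"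
      "n = (real n1 + real n2) / 2" "0 < \<epsilon>" "\<epsilon> \<le> \<epsilon>1"
      "real m \<ge> (1600 * (33 / ln (1 / \<epsilon>1) + 6)) * ((1 / \<epsilon>\<^sup>2) * ln (1 / \<epsilon>)) * n * real r * ln n"
      by simp_all
    obtain R where R: "finite R" "R \<subseteq> unit_low_rank n1 n2 (2 * r)"
      "real (card R) \<le> 2 * exp (real m * \<epsilon>\<^sup>2 / 400)"
      "\<forall>F\<in>unit_low_rank n1 n2 (2 * r). \<exists>H\<in>R.
        (\<Sum>p\<in>{..<n1} \<times> {..<n2}. (F $$ p - H $$ p)\<^sup>2) \<le> \<epsilon> ^ 3 / (320 * real (n1 * n2))"
      using low_rank_net_size[OF h'(1-7) conjunct2[OF \<epsilon>1] h'(8)] by blast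
    have "\<epsilon> < 1" using h' \<epsilon>1 by simp
    have levels: "(\<forall>\<tau>\<in>levels. P \<tau>) \<longleftrightarrow> P (1/2) \<and> P 0.49 \<and> P 0.51" for P
      unfolding levels_def by blast
    show "measure M {\<omega> \<in> space M.
            \<forall>G \<in> carrier_mat n1 n2. vec_space.rank n1 G \<le> 2 * r \<longrightarrow>
              (let y = map_vec abs (sensing_map m (\<lambda>i. A i \<omega>) G);
                   q = abs_normal_quantile
               in sample_quantile (1/2) y
                    \<in> scale_set {q (1/2) - \<epsilon> .. q (1/2) + \<epsilon>} (frobenius_norm G) \<and>
                  sample_quantile 0.49 y
                    \<in> scale_set {q 0.49 - \<epsilon> .. q 0.49 + \<epsilon>} (frobenius_norm G) \<and>
                  sample_quantile 0.51 y
                    \<in> scale_set {q 0.51 - \<epsilon> .. q 0.51 + \<epsilon>} (frobenius_norm G))}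
            \<ge> 1 - 13 * exp (- (1 / 3200) * real m * \<epsilon>\<^sup>2)"
      using low_rank_concentration[OF h'(1-4) h'(6) \<open>\<epsilon> < 1\<close> R(1,2) R(4)[rule_format]]
        failure_probability_bound[OF R(3)]
      unfolding levels Let_def by linarith
  qed
  \<comment> \<open>The constants 13 and \<open>1 / 3200\<close> are chosen before
    \<open>\<epsilon>1\<close> and hence do not depend on it.\<close>
  show ?thesis
    by (rule conjI[OF q(1) conjI[OF q(2) conjI[OF q(3)]]], rule exI[of _ 13], rule conjI, simp,
        rule exI[of _ "1 / 3200"], rule conjI, simp, rule allI, rule impI, rule main)
qed

end
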